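(* Let $\Omega\subset\mathbb{R}^2$ be a bounded domain with smooth boundary, and let $\mathbf{B}$ be a smooth $2$-form (magnetic field) on $\Omega$. For every connected component $\mathcal{C}$ of $\partial\Omega$, write $\mathbf{B}=B(n,s)\,dn\wedge ds$ on the collar $\Omega_{\mathcal{C}}(N)$ using the normal coordinates $(n,s)$ (defined in the context). Suppose that for every component $\mathcal{C}$ and every $s$, $$\lim_{n\to 0^+}\left|\int_n^N B(u,s)\,du\right|=\infty ,$$ and that for every component $\mathcal{C}$ there is a constant $D_{\mathcal{C}}$ such that $$\sup_s\int_0^N\left|\frac{\partial B}{\partial s}(u,s)\right|du<D_{\mathcal{C}} .$$ Let $\mathbf{A}$ be a smooth $1$-form on $\Omega$ with $d\mathbf{A}=\mathbf{B}$. Then the Hamiltonian flow on $T^*\Omega$ (with its canonical symplectic structure) defined by $$H(q,p)=\frac{|p-e\mathbf{A}(q)|_*^2}{2m}$$ is complete, i.e. every integral curve of the Hamiltonian vector field of $H$ extends to all times $t\in\mathbb{R}$.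
   Context: $\mathbb{R}^2$ carries the Euclidean metric, and $|\cdot|_*$ denotes the induced norm on $T^*\Omega$; a domain is a connected open set. Fix a mass $m>0$ and a charge $e\neq 0$. Normal coordinates: let $\mathcal{C}$ be a connected component of $\partial\Omega$, of length $L$. Let $\gamma:\mathbb{R}/L\mathbb{Z}\to\mathcal{C}$ be an arc length parametrization and let $\nu(s)$ be the unit normal to $\mathcal{C}$ at $\gamma(s)$ pointing into $\Omega$. Define $x(n,s)=\gamma(s)+n\nu(s)$. A number $N>0$ is fixed, small enough that for every component $\mathcal{C}$ there is $N'>N$ for which $x$ is a diffeomorphism of $(0,N')\times\mathbb{R}/L\mathbb{Z}$ onto an open subset of $\Omega$. The collar $\Omega_{\mathcal{C}}(N)\subset\Omega$ is the image $x\big((0,N)\times\mathbb{R}/L\mathbb{Z}\big)$. The function $B(n,s)$ is the coefficient of $\mathbf{B}$ with respect to $dn\wedge ds$ in these coordinates (it depends on $\mathcal{C}$). *)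

theory Defs
  imports "HOL-Analysis.Analysis"
begin

type_synonym plane = "real^2"

text \<open>Covectors are bounded linear functionals. Their norm is the operator norm, which is the norm
  on cotangent spaces induced by the Euclidean metric. The cotangent bundle of an open set
  \<open>\<Omega>\<close> of the plane is \<open>\<Omega> \<times> UNIV\<close> in \<open>plane \<times> covector\<close>.\<close>

type_synonym covector = "plane \<Rightarrow>\<^sub>L real"


subsection \<open>Smooth maps on open sets\<close>

text \<open>Only meant for open sets, since derivatives are taken in full neighbourhoods. As the domain
  is finite-dimensional, continuity of all directional derivatives is continuity of the
  derivative.\<close>

primrec Ck_on ::
  "nat \<Rightarrow> 'a::euclidean_space set \<Rightarrow> ('a \<Rightarrow> 'b::real_normed_vector) \<Rightarrow> bool" where
  "Ck_on 0 S f \<longleftrightarrow> continuous_on S f"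
| "Ck_on (Suc k) S f \<longleftrightarrow>
     (\<forall>x\<in>S. f differentiable (at x)) \<and> (\<forall>v. Ck_on k S (\<lambda>x. frechet_derivative f (at x) v))"

definition smooth_on ::
  "'a::euclidean_space set \<Rightarrow> ('a \<Rightarrow> 'b::real_normed_vector) \<Rightarrow> bool" where
  "smooth_on S f \<longleftrightarrow> (\<forall>k. Ck_on k S f)"


subsection \<open>Bounded domains with smooth boundary\<close>

text \<open>Near each of its boundary points, the set is the positivity set of a smooth function without
  critical points. In particular it lies on one side of its boundary.\<close>

definition smooth_boundary :: "plane set \<Rightarrow> bool" where
  "smooth_boundary \<Omega> \<longleftrightarrow>
     (\<forall>p\<in>frontier \<Omega>. \<exists>U (f :: plane \<Rightarrow> real). open U \<and> p \<in> U \<and> smooth_on U f \<and>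
        (\<forall>x\<in>U. frechet_derivative f (at x) \<noteq> (\<lambda>v. 0)) \<and>
        \<Omega> \<inter> U = {x \<in> U. f x > 0})"

definition bounded_smooth_domain :: "plane set \<Rightarrow> bool" where
  "bounded_smooth_domain \<Omega> \<longleftrightarrow>
     open \<Omega> \<and> connected \<Omega> \<and> bounded \<Omega> \<and> smooth_boundary \<Omega>"


subsection \<open>Differential forms on open sets of the plane\<close>

definition smooth_1form :: "plane set \<Rightarrow> (plane \<Rightarrow> covector) \<Rightarrow> bool" where
  "smooth_1form \<Omega> A \<longleftrightarrow> smooth_on \<Omega> A"

definition smooth_2form :: "plane set \<Rightarrow> (plane \<Rightarrow> plane \<Rightarrow>\<^sub>L covector) \<Rightarrow> bool" where
  "smooth_2form \<Omega> B \<longleftrightarrow>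
     smooth_on \<Omega> B \<and> (\<forall>q\<in>\<Omega>. \<forall>u. blinfun_apply (blinfun_apply (B q) u) u = 0)"

definition ext_deriv :: "(plane \<Rightarrow> covector) \<Rightarrow> plane \<Rightarrow> plane \<Rightarrow> plane \<Rightarrow> real" where
  "ext_deriv A q u v =
     blinfun_apply (frechet_derivative A (at q) u) v -
     blinfun_apply (frechet_derivative A (at q) v) u"


subsection \<open>Normal coordinates\<close>

text \<open>Functions on the circle of length \<open>L\<close> are rendered as \<open>L\<close>-periodic functions on the
  line.\<close>

definition arclength_param :: "plane set \<Rightarrow> real \<Rightarrow> (real \<Rightarrow> plane) \<Rightarrow> bool" where
  "arclength_param C L \<gamma> \<longleftrightarrow>
     L > 0 \<and> smooth_on UNIV \<gamma> \<and>
     (\<forall>s. norm (vector_derivative \<gamma> (at s)) = 1) \<and>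
     (\<forall>s t. \<gamma> s = \<gamma> t \<longleftrightarrow> (\<exists>k::int. t = s + of_int k * L)) \<and>
     range \<gamma> = C"

definition inward_unit_normal ::
  "plane set \<Rightarrow> (real \<Rightarrow> plane) \<Rightarrow> (real \<Rightarrow> plane) \<Rightarrow> bool" where
  "inward_unit_normal \<Omega> \<gamma> \<nu> \<longleftrightarrow>
     (\<forall>s. norm (\<nu> s) = 1 \<and> \<nu> s \<bullet> vector_derivative \<gamma> (at s) = 0 \<and>
          (\<forall>\<^sub>F n in at_right 0. \<gamma> s + n *\<^sub>R \<nu> s \<in> \<Omega>))"

definition normal_map :: "(real \<Rightarrow> plane) \<Rightarrow> (real \<Rightarrow> plane) \<Rightarrow> real \<times> real \<Rightarrow> plane" where
  "normal_map \<gamma> \<nu> = (\<lambda>(n, s). \<gamma> s + n *\<^sub>R \<nu> s)"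

text \<open>\<open>F\<close> induces a diffeomorphism of the quotient of \<open>{0<..<b} \<times> \<real>\<close> by the
  translations \<open>(n, s) \<mapsto> (n, s + k L)\<close> onto the open set \<open>V\<close>. As the quotient map is a
  covering, the inverse is smooth iff it has smooth lifts \<open>g\<close> near each point of \<open>V\<close>.\<close>

definition cylinder_diffeo ::
  "real \<Rightarrow> real \<Rightarrow> (real \<times> real \<Rightarrow> plane) \<Rightarrow> plane set \<Rightarrow> bool" where
  "cylinder_diffeo b L F V \<longleftrightarrow>
     smooth_on ({0<..<b} \<times> UNIV) F \<and>
     (\<forall>n\<in>{0<..<b}. \<forall>n'\<in>{0<..<b}. \<forall>s s'.
        F (n, s) = F (n', s') \<longleftrightarrow> n = n' \<and> (\<exists>k::int. s' = s + of_int k * L)) \<and>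
     F ` ({0<..<b} \<times> UNIV) = V \<and> open V \<and>
     (\<forall>y\<in>V. \<exists>W g. open W \<and> y \<in> W \<and> W \<subseteq> V \<and> smooth_on W g \<and>
        (\<forall>w\<in>W. g w \<in> {0<..<b} \<times> UNIV \<and> F (g w) = w))"

text \<open>The coefficient of \<open>dn \<and> ds\<close> is the value of the form on the pair of coordinate vectors
  \<open>\<partial>x/\<partial>n\<close>, \<open>\<partial>x/\<partial>s\<close>.\<close>

definition normal_coeff ::
  "(plane \<Rightarrow> plane \<Rightarrow>\<^sub>L covector) \<Rightarrow> (real \<Rightarrow> plane) \<Rightarrow> (real \<Rightarrow> plane) \<Rightarrow> real \<Rightarrow> real \<Rightarrow> real" where
  "normal_coeff B \<gamma> \<nu> n s =
     blinfun_apply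
       (blinfun_apply (B (normal_map \<gamma> \<nu> (n, s)))
         (vector_derivative (\<lambda>u. normal_map \<gamma> \<nu> (u, s)) (at n)))
       (vector_derivative (\<lambda>t. normal_map \<gamma> \<nu> (n, t)) (at s))"


subsection \<open>Hamiltonian flows on the cotangent bundle\<close>

text \<open>The symplectic form is the sum of the \<open>dq\<^sub>i \<and> dp\<^sub>i\<close>, and the Hamiltonian vector
  field \<open>X\<close> satisfies \<open>\<omega>(X, -) = dH\<close>, which gives Hamilton's equations
  \<open>dq/dt = \<partial>H/\<partial>p\<close>, \<open>dp/dt = -\<partial>H/\<partial>q\<close>.\<close>

definition canonical_symplectic :: "plane \<times> covector \<Rightarrow> plane \<times> covector \<Rightarrow> real" where
  "canonical_symplectic X Y = blinfun_apply (snd Y) (fst X) - blinfun_apply (snd X) (fst Y)"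

definition hamiltonian_vector_field ::
  "(plane \<times> covector \<Rightarrow> real) \<Rightarrow> plane \<times> covector \<Rightarrow> plane \<times> covector" where
  "hamiltonian_vector_field H z =
     (THE X. \<forall>Y. canonical_symplectic X Y = frechet_derivative H (at z) Y)"

definition integral_curve ::
  "('a::real_normed_vector \<Rightarrow> 'a) \<Rightarrow> 'a set \<Rightarrow> real set \<Rightarrow> (real \<Rightarrow> 'a) \<Rightarrow> bool" where
  "integral_curve X M I c \<longleftrightarrow>
     (\<forall>t\<in>I. c t \<in> M \<and> (c has_vector_derivative X (c t)) (at t))"

definition complete_on :: "('a::real_normed_vector \<Rightarrow> 'a) \<Rightarrow> 'a set \<Rightarrow> bool" where
  "complete_on X M \<longleftrightarrow>
     (\<forall>I c. open I \<and> is_interval I \<and> I \<noteq> {} \<and> integral_curve X M I c \<longrightarrow>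
        (\<exists>c'. integral_curve X M UNIV c' \<and> (\<forall>t\<in>I. c' t = c t)))"

definition magnetic_hamiltonian ::
  "real \<Rightarrow> real \<Rightarrow> (plane \<Rightarrow> covector) \<Rightarrow> plane \<times> covector \<Rightarrow> real" where
  "magnetic_hamiltonian m e A = (\<lambda>(q, p). (norm (p - e *\<^sub>R A q))\<^sup>2 / (2 * m))"

end

(*
  The speed of the particle is constant, so as t approaches a finite endpoint of a maximal solution
  the position converges to a point of the closure of the domain. If the limit is an interior point,
  the solution stays in a compact part of the phase space and can be continued. If it is a boundary
  point gamma(s0), use the gauge A = -a(n,s) ds with a(n,s) = int_n^N B(u,s) du near it: there the
  momentum m <q', dx/ds> - e a(n,s) conjugate to s changes at a bounded rate, because |da/ds| <= D
  and the Euclidean metric is smooth up to the boundary in normal coordinates. Hence a stays bounded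
  along the solution, contradicting |a(n,s)| >= |a(n,s0)| - D |s - s0| -> infinity as n -> 0.
*)

theory Submission
  imports Defs
begin

subsection \<open>Locally Lipschitz vector fields\<close>

text \<open>The collar hypothesis gives coordinates only for \<open>n > 0\<close>. That a point of
  \<open>\<Omega>\<close> close to \<open>\<gamma> s0\<close> has small positive \<open>n\<close>
  and \<open>s\<close> close to \<open>s0\<close> has to be derived: the normal map is extended to
  \<open>n \<le> 0\<close> and inverted at \<open>(0, s0)\<close>, and a local defining function of
  \<open>\<Omega>\<close> shows that the side \<open>n \<le> 0\<close> lies outside. The change of
  gauge is never carried out. Newton's law for the velocity contains only the field, and the
  momentum conjugate to \<open>s\<close> is introduced directly through velocity and flux, so
  \<open>A\<close> is never compared with the local potential. At an interior limit the velocity is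
  not shown to converge. Bounded speed gives a cluster point in phase space, and this suffices for
  continuation because the local existence time is uniform near that point.\<close>

definition loclip_on :: "'a::metric_space set \<Rightarrow> ('a \<Rightarrow> 'b::metric_space) \<Rightarrow> bool" where
  "loclip_on S f \<longleftrightarrow> (\<forall>x\<in>S. \<exists>r>0. \<exists>K. K-lipschitz_on (ball x r \<inter> S) f)"

lemma integral_curve_subset:
  "integral_curve X M I c \<Longrightarrow> J \<subseteq> I \<Longrightarrow> integral_curve X M J c"
  by (auto simp: integral_curve_def)

lemma integral_curve_cong:
  assumes "integral_curve X M J d" "open J" "\<And>t. t \<in> J \<Longrightarrow> c t = d t"
  shows "integral_curve X M J c"
  unfolding integral_curve_def
proof
  fix t assume t: "t \<in> J"
  have "(d has_vector_derivative X (d t)) (at t)" "d t \<in> M"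
    using assms(1) t by (auto simp: integral_curve_def)
  moreover have "(c has_vector_derivative X (d t)) (at t)"
    by (rule has_vector_derivative_transform_within_open[OF calculation(1) assms(2) t])
      (simp add: assms(3))
  ultimately show "c t \<in> M \<and> (c has_vector_derivative X (c t)) (at t)"
    using assms(3)[OF t] by simp
qed

text \<open>Mean value inequality for curves. It serves the contraction estimate, uniqueness,
  conservation of speed and the drift of the conjugate momentum alike.\<close>

lemma vector_derivative_bound:
  fixes f :: "real \<Rightarrow> 'a::real_normed_vector"
  assumes "convex S"
    and "\<And>x. x \<in> S \<Longrightarrow> (f has_vector_derivative f' x) (at x within S)"
    and "\<And>x. x \<in> S \<Longrightarrow> norm (f' x) \<le> B"
    and "x \<in> S" "y \<in> S"
  shows "norm (f x - f y) \<le> B * \<bar>x - y\<bar>"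
proof -
  have "norm (f x - f y) \<le> B * norm (x - y)"
    by (rule differentiable_bound[of S f "\<lambda>x h. h *\<^sub>R f' x"])
      (use assms in \<open>auto simp: has_vector_derivative_def intro!: onorm_le
        mult_left_mono simp: mult.commute[of B]\<close>)
  then show ?thesis by simp
qed

section \<open>Local existence by Picard iteration\<close>

lemma loclip_on_imp_continuous_on:
  assumes "loclip_on S f"
  shows "continuous_on S f"
  unfolding continuous_on_eq_continuous_within
proof
  fix x assume x: "x \<in> S"
  then obtain r K where r: "r > 0" "K-lipschitz_on (ball x r \<inter> S) f"
    using assms by (auto simp: loclip_on_def)
  have "continuous_on (ball x r \<inter> S) f"
    using r(2) by (rule lipschitz_on_continuous_on)
  then have "continuous (at x within ball x r \<inter> S) f"
    using x r(1) by (simp add: continuous_on_eq_continuous_within)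
  moreover have "at x within ball x r \<inter> S = at x within S"
    by (rule at_within_nhd[of x "ball x r"]) (use r(1) in auto)
  ultimately show "continuous (at x within S) f" by simp
qed

text \<open>Picard iteration. The point is that \<open>\<epsilon>\<close> and \<open>r\<close>
  depend neither on the initial time \<open>t0\<close> nor on the initial value \<open>z\<close>;
  continuation past an endpoint rests on this uniformity.\<close>

lemma local_flow_exists:
  fixes X :: "'a::banach \<Rightarrow> 'a"
  assumes "open M" "loclip_on M X" "l \<in> M"
  obtains \<epsilon> r where "\<epsilon> > 0" "r > 0"
    "\<And>t0 z. z \<in> ball l r \<Longrightarrow> \<exists>c. integral_curve X M (ball t0 \<epsilon>) c \<and> c t0 = z"
proof -
  obtain r0 K where r0: "r0 > 0" "K-lipschitz_on (ball l r0 \<inter> M) X"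
    using assms by (auto simp: loclip_on_def)
  obtain r1 where r1: "r1 > 0" "ball l r1 \<subseteq> M"
    using assms by (auto simp: open_contains_ball)
  \<comment> \<open>With a third of the smaller radius, \<open>cball z r\<close> lies in
    \<open>cball l (2*r)\<close> for every \<open>z\<close> in \<open>ball l r\<close>, and the
    latter in the region where \<open>X\<close> is Lipschitz.\<close>
  define r where "r = min r0 r1 / 3"
  have r: "r > 0" using r0 r1 by (auto simp: r_def)
  have sub: "cball l (2*r) \<subseteq> ball l r0 \<inter> M"
    using r0 r1 by (auto simp: r_def)
  have lip: "K-lipschitz_on (cball l (2*r)) X"
    using r0(2) sub by (rule lipschitz_on_subset)
  have K: "K \<ge> 0" using lip by (rule lipschitz_on_nonneg)
  define Bd where "Bd = norm (X l) + K * (2*r)"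
  have Bd: "norm (X y) \<le> Bd" if "y \<in> cball l (2*r)" for y
  proof -
    have "norm (X y - X l) \<le> K * dist y l"
      using lipschitz_onD[OF lip that, of l] r by (simp add: dist_norm)
    also have "\<dots> \<le> K * (2*r)"
      using that K by (intro mult_left_mono) (auto simp: dist_commute)
    finally show ?thesis
      unfolding Bd_def using norm_triangle_sub[of "X y" "X l"] by linarith
  qed
  have Bd0: "Bd \<ge> 0" using K r by (auto simp: Bd_def)
  \<comment> \<open>The first bound keeps the iterates, moving at speed at most \<open>Bd\<close>,
    within distance \<open>r\<close> of \<open>z\<close>; the second makes the Picard operator a
    contraction with factor 1/2. Adding 1 guards against division by zero.\<close>
  define \<epsilon> where "\<epsilon> = min (r / (Bd + 1)) (1 / (2 * (K + 1)))"
  have \<epsilon>: "\<epsilon> > 0" using Bd0 K r by (auto simp: \<epsilon>_def)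
  have \<epsilon>B: "Bd * \<epsilon> \<le> r"
  proof -
    have "Bd * \<epsilon> \<le> Bd * (r / (Bd + 1))"
      by (intro mult_left_mono) (auto simp: \<epsilon>_def Bd0)
    also have "\<dots> \<le> r" using Bd0 r by (simp add: field_simps)
    finally show ?thesis .
  qed
  have \<epsilon>K: "K * \<epsilon> \<le> 1/2"
  proof -
    have "K * \<epsilon> \<le> K * (1 / (2 * (K + 1)))"
      by (intro mult_left_mono) (auto simp: \<epsilon>_def K)
    also have "\<dots> \<le> 1/2" using K by (simp add: field_simps)
    finally show ?thesis .
  qed
  have "\<exists>c. integral_curve X M (ball t0 \<epsilon>) c \<and> c t0 = z" if z: "z \<in> ball l r" for t0 z
  proof -
    define a b where "a = t0 - \<epsilon>" and "b = t0 + \<epsilon>"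
    have ab: "a < b" "t0 \<in> {a..b}" using \<epsilon> by (auto simp: a_def b_def)
    \<comment> \<open>The complete space of bounded continuous functions is used on the whole line,
      so time is clamped to \<open>{a..b}\<close> and iterates are constant outside.\<close>
    define cl where "cl t = max a (min b t)" for t :: real
    have cl: "cl t \<in> {a..b}" for t using ab by (auto simp: cl_def)
    have clc: "continuous_on UNIV cl" unfolding cl_def by (intro continuous_intros)
    define S where "S = PiC UNIV (\<lambda>_::real. cball z r)"
    have S: "f \<in> S \<longleftrightarrow> (\<forall>t. apply_bcontfun f t \<in> cball z r)" for f
      by (auto simp: S_def mem_PiC_iff)
    have zr: "cball z r \<subseteq> cball l (2*r)"
      using z by (auto simp: dist_commute) (smt (verit) dist_commute dist_triangle)
    \<comment> \<open>Integrating from \<open>a\<close> and subtracting the value at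
      \<open>t0\<close> replaces the oriented integral from \<open>t0\<close> to
      \<open>t\<close>.\<close>
    define G where "G f t = integral {a..t} (\<lambda>u. X (apply_bcontfun f u))" for f t
    define T where "T f t = z + G f (cl t) - G f t0" for f t
    have hc: "continuous_on UNIV (\<lambda>u. X (apply_bcontfun f u))" if "f \<in> S" for f
    proof (rule continuous_on_compose2[of "cball l (2*r)" X])
      show "continuous_on (cball l (2*r)) X" using lip by (rule lipschitz_on_continuous_on)
    qed (use that zr in \<open>auto simp: S\<close>)
    have Gd: "(G f has_vector_derivative X (apply_bcontfun f t)) (at t within {a..b})"
      if "f \<in> S" "t \<in> {a..b}" for f t
      unfolding G_def
      by (rule integral_has_vector_derivative)
        (use that continuous_on_subset[OF hc] in auto)
    have Gc: "continuous_on {a..b} (G f)" if "f \<in> S" for f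
      using Gd[OF that] by (rule continuous_on_vector_derivative)
    have dcl: "\<bar>cl t - t0\<bar> \<le> \<epsilon>" for t using cl[of t] by (auto simp: a_def b_def)
    have Tz: "T f t \<in> cball z r" if "f \<in> S" for f t
    proof -
      have "norm (G f (cl t) - G f t0) \<le> Bd * \<bar>cl t - t0\<bar>"
        by (rule vector_derivative_bound[OF _ Gd[OF that]])
          (use ab cl that zr in \<open>auto intro!: Bd simp: S\<close>)
      also have "\<dots> \<le> Bd * \<epsilon>" using dcl Bd0 by (intro mult_left_mono)
      also note \<epsilon>B
      finally show ?thesis by (simp add: T_def dist_norm norm_minus_commute algebra_simps)
    qed
    have Tbc: "T f \<in> bcontfun" if "f \<in> S" for f
    proof -
      have "continuous_on UNIV (T f)"
        unfolding T_def
        by (intro continuous_intros continuous_on_compose2[OF Gc[OF that] clc]) (use cl in auto)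
      moreover have "bounded (range (T f))"
        by (rule bounded_subset[of "cball z r"]) (use Tz[OF that] in auto)
      ultimately show ?thesis by (simp add: bcontfun_def)
    qed
    define TT where "TT f = Bcontfun (T f)" for f
    have TT: "apply_bcontfun (TT f) = T f" if "f \<in> S" for f
      using Tbc[OF that] by (simp add: TT_def Bcontfun_inverse)
    have "\<exists>!f\<in>S. TT f = f"
    proof (rule Banach_fix)
      show "complete S" unfolding S_def
        by (simp add: complete_eq_closed closed_PiC)
      have "const_bcontfun z \<in> S" using r by (simp add: S const_bcontfun.rep_eq)
      then show "S \<noteq> {}" by auto
      show "TT ` S \<subseteq> S"
        using Tz by (auto simp: S[of "TT _"] TT simp del: mem_cball)
      show "dist (TT f) (TT g) \<le> 1/2 * dist f g" if fg: "f \<in> S" "g \<in> S" for f g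
      proof (rule dist_bound)
        fix t
        have "norm ((\<lambda>t. G f t - G g t) (cl t) - (\<lambda>t. G f t - G g t) t0)
          \<le> (K * dist f g) * \<bar>cl t - t0\<bar>"
        proof (rule vector_derivative_bound[of "{a..b}"])
          fix x assume "x \<in> {a..b}"
          then show "((\<lambda>t. G f t - G g t) has_vector_derivative
              X (apply_bcontfun f x) - X (apply_bcontfun g x)) (at x within {a..b})"
            by (intro has_vector_derivative_diff Gd) (use fg in auto)
          have "norm (X (apply_bcontfun f x) - X (apply_bcontfun g x))
            \<le> K * dist (apply_bcontfun f x) (apply_bcontfun g x)"
            unfolding dist_norm[symmetric]
            by (rule lipschitz_onD[OF lip]) (use fg zr in \<open>auto simp del: mem_cball simp: S\<close>)
          also have "\<dots> \<le> K * dist f g"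
            using K by (intro mult_left_mono dist_bounded)
          finally show "norm (X (apply_bcontfun f x) - X (apply_bcontfun g x)) \<le> K * dist f g" .
        qed (use ab cl in auto)
        also have "\<dots> \<le> (K * dist f g) * \<epsilon>" using dcl K by (intro mult_left_mono) auto
        also have "\<dots> = (K * \<epsilon>) * dist f g" by simp
        also have "\<dots> \<le> 1/2 * dist f g" by (intro mult_right_mono \<epsilon>K) auto
        finally show "dist (apply_bcontfun (TT f) t) (apply_bcontfun (TT g) t) \<le> 1/2 * dist f g"
          using fg by (simp add: TT T_def dist_norm algebra_simps)
      qed
    qed auto
    then obtain f where f: "f \<in> S" "TT f = f" by auto
    have fT: "apply_bcontfun f t = z + G f (cl t) - G f t0" for t
      using TT[OF f(1)] f(2) by (simp add: T_def)
    have "cl t0 = t0" using ab by (auto simp: cl_def)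
    then have "apply_bcontfun f t0 = z" by (simp add: fT)
    moreover have "integral_curve X M (ball t0 \<epsilon>) (apply_bcontfun f)"
      unfolding integral_curve_def
    proof
      fix t assume t: "t \<in> ball t0 \<epsilon>"
      then have t': "t \<in> {a<..<b}" by (auto simp: a_def b_def dist_real_def)
      have "(G f has_vector_derivative X (apply_bcontfun f t)) (at t within {a<..<b})"
        by (rule has_vector_derivative_within_subset[OF Gd[OF f(1)]]) (use t' in auto)
      then have "(G f has_vector_derivative X (apply_bcontfun f t)) (at t)"
        using t' by (simp add: at_within_open[of t "{a<..<b}"])
      then have "((\<lambda>t. z + G f t - G f t0) has_vector_derivative X (apply_bcontfun f t)) (at t)"
        by (auto intro!: derivative_eq_intros)
      then have "(apply_bcontfun f has_vector_derivative X (apply_bcontfun f t)) (at t)"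
        by (rule has_vector_derivative_transform_within_open[of _ _ _ "{a<..<b}"])
          (use t' in \<open>auto simp: fT cl_def\<close>)
      moreover have "apply_bcontfun f t \<in> M" using f(1) zr sub unfolding S by blast
      ultimately show "apply_bcontfun f t \<in> M \<and>
          (apply_bcontfun f has_vector_derivative X (apply_bcontfun f t)) (at t)" by simp
    qed
    ultimately show ?thesis by blast
  qed
  then show ?thesis using that \<epsilon> r by blast
qed

section \<open>Uniqueness and continuation of integral curves\<close>

lemma integral_curve_continuous_on:
  assumes "integral_curve X M J c" "open J"
  shows "continuous_on J c"
  using assms
  by (auto simp: integral_curve_def continuous_on_eq_continuous_at
      intro: has_vector_derivative_continuous)

text \<open>The set where the curves agree is closed in \<open>J\<close> by continuity and open by a
  Lipschitz estimate on short intervals; connectedness of \<open>J\<close> finishes.\<close>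

lemma integral_curve_unique:
  fixes X :: "'a::real_normed_vector \<Rightarrow> 'a"
  assumes "open M" "loclip_on M X" "open J" "is_interval J"
    and c: "integral_curve X M J c" and d: "integral_curve X M J d"
    and t0: "t0 \<in> J" "c t0 = d t0" and t: "t \<in> J"
  shows "c t = d t"
proof -
  note cc = integral_curve_continuous_on[OF c \<open>open J\<close>]
  note dc = integral_curve_continuous_on[OF d \<open>open J\<close>]
  define S where "S = {t \<in> J. c t - d t = 0}"
  have "closedin (top_of_set J) S"
    unfolding S_def by (intro continuous_closedin_preimage_constant continuous_intros cc dc)
  moreover have "open S"
  proof (subst open_contains_ball, intro ballI)
    fix t1 assume "t1 \<in> S"
    then have t1: "t1 \<in> J" "c t1 = d t1" by (auto simp: S_def)
    define z where "z = c t1"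
    have z: "z \<in> M" using c t1 by (auto simp: integral_curve_def z_def)
    then obtain r K where r: "r > 0" and lip: "K-lipschitz_on (ball z r \<inter> M) X"
      using assms(2) by (auto simp: loclip_on_def)
    have K: "K \<ge> 0" using lip by (rule lipschitz_on_nonneg)
    have "open (J \<inter> c -` ball z r)" "open (J \<inter> d -` ball z r)"
      using continuous_open_preimage[OF cc \<open>open J\<close>] continuous_open_preimage[OF dc \<open>open J\<close>]
      by auto
    then have "open ((J \<inter> c -` ball z r) \<inter> (J \<inter> d -` ball z r))" by (rule open_Int)
    moreover have "t1 \<in> (J \<inter> c -` ball z r) \<inter> (J \<inter> d -` ball z r)"
      using t1 r by (auto simp: z_def)
    ultimately obtain h0 where h0: "h0 > 0"
      "cball t1 h0 \<subseteq> (J \<inter> c -` ball z r) \<inter> (J \<inter> d -` ball z r)"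
      by (meson open_contains_cball)
    define h where "h = min h0 (1 / (2 * (K + 1)))"
    have h: "h > 0" using h0 K by (auto simp: h_def)
    have hs: "cball t1 h \<subseteq> cball t1 h0" by (auto simp: h_def)
    have hK: "K * h \<le> 1/2"
    proof -
      have "K * h \<le> K * (1 / (2 * (K + 1)))"
        by (intro mult_left_mono) (auto simp: h_def K)
      also have "\<dots> \<le> 1/2" using K by (simp add: field_simps)
      finally show ?thesis .
    qed
    have hJ: "cball t1 h \<subseteq> J" using hs h0 by auto
    have "continuous_on (cball t1 h) (\<lambda>t. norm (c t - d t))"
      by (intro continuous_intros continuous_on_subset[OF cc hJ] continuous_on_subset[OF dc hJ])
    \<comment> \<open>At the maximum \<open>B\<close> of the distance, integrating the Lipschitz
      bound over a time at most \<open>h\<close> yields \<open>B \<le> B/2\<close>, hence the curves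
      coincide near \<open>t1\<close>.\<close>
    then obtain tm where tm: "tm \<in> cball t1 h"
      "\<And>t. t \<in> cball t1 h \<Longrightarrow> norm (c t - d t) \<le> norm (c tm - d tm)"
      using continuous_attains_sup[of "cball t1 h" "\<lambda>t. norm (c t - d t)"] h by fastforce
    define B where "B = norm (c tm - d tm)"
    have "norm ((\<lambda>t. c t - d t) tm - (\<lambda>t. c t - d t) t1) \<le> (K * B) * \<bar>tm - t1\<bar>"
    proof (rule vector_derivative_bound[of "cball t1 h"])
      fix x assume x: "x \<in> cball t1 h"
      have cd: "(c has_vector_derivative X (c x)) (at x)" "(d has_vector_derivative X (d x)) (at x)"
        "c x \<in> M" "d x \<in> M"
        using c d x hJ unfolding integral_curve_def by blast+
      show "((\<lambda>t. c t - d t) has_vector_derivative X (c x) - X (d x)) (at x within cball t1 h)"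
        by (intro has_vector_derivative_diff has_vector_derivative_at_within[OF cd(1)]
            has_vector_derivative_at_within[OF cd(2)])
      have "norm (X (c x) - X (d x)) \<le> K * norm (c x - d x)"
        using lipschitz_onD[OF lip, of "c x" "d x"] cd h0 hs x by (auto simp: dist_norm subset_iff)
      also have "\<dots> \<le> K * B" using K tm(2)[OF x] by (simp add: B_def mult_left_mono)
      finally show "norm (X (c x) - X (d x)) \<le> K * B" .
    qed (use tm h in auto)
    also have "\<dots> \<le> (K * B) * h"
      using tm K by (intro mult_left_mono) (auto simp: B_def dist_real_def abs_minus_commute)
    also have "\<dots> = (K * h) * B" by simp
    also have "\<dots> \<le> 1/2 * B" by (intro mult_right_mono hK) (simp add: B_def)
    finally have "B \<le> 1/2 * B" using t1 by (simp add: B_def)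
    then have "B = 0" using norm_ge_zero[of "c tm - d tm"] by (simp add: B_def)
    then have "c t = d t" if "t \<in> cball t1 h" for t using tm(2)[OF that] by (simp add: B_def)
    then have "ball t1 h \<subseteq> S" using hJ by (auto simp: S_def subset_iff)
    then show "\<exists>e>0. ball t1 e \<subseteq> S" using h by blast
  qed
  then have "openin (top_of_set J) S" by (auto simp: S_def open_subset)
  moreover have "connected J" using assms(4) by (simp add: is_interval_connected_1)
  moreover have "t0 \<in> S" using t0 by (simp add: S_def)
  ultimately have "S = J" unfolding connected_clopen by blast
  then show ?thesis using t by (auto simp: S_def)
qed

text \<open>A cluster point in \<open>M\<close> at each finite endpoint is enough: a local solution
  started at a time close to \<open>b\<close> and at a value close to \<open>l\<close> lives long
  enough to pass \<open>b\<close>.\<close>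

lemma complete_onI:
  fixes X :: "'a::banach \<Rightarrow> 'a"
  assumes "open M" "loclip_on M X"
    and cluster: "\<And>I c b. open I \<Longrightarrow> is_interval I \<Longrightarrow> integral_curve X M I c \<Longrightarrow>
      b \<in> closure I \<Longrightarrow> b \<notin> I \<Longrightarrow>
      \<exists>l\<in>M. \<forall>r>0. \<forall>\<epsilon>>0. \<exists>t\<in>I. dist t b < \<epsilon> \<and> dist (c t) l < r"
  shows "complete_on X M"
  unfolding complete_on_def
proof (intro allI impI, elim conjE)
  fix I c assume I: "open I" "is_interval I" "I \<noteq> {}" and c: "integral_curve X M I c"
  \<comment> \<open>All extensions to open intervals agree where they overlap, so their union is the
    maximal one and Zorn's lemma is avoided.\<close>
  define E where "E = {(J, d). open J \<and> is_interval J \<and> I \<subseteq> J \<and> integral_curve X M J d \<and>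
    (\<forall>t\<in>I. d t = c t)}"
  obtain i where i: "i \<in> I" using I by auto
  have agree: "d1 t = d2 t" if "(J1, d1) \<in> E" "(J2, d2) \<in> E" "t \<in> J1" "t \<in> J2" for J1 d1 J2 d2 t
  proof (rule integral_curve_unique[OF assms(1,2), of "J1 \<inter> J2" d1 d2 i])
    show "integral_curve X M (J1 \<inter> J2) d1" "integral_curve X M (J1 \<inter> J2) d2"
      using that by (auto simp: E_def intro: integral_curve_subset)
  qed (use that i in \<open>auto simp: E_def is_interval_Int subset_iff\<close>)
  define U where "U = \<Union> (fst ` E)"
  define c' where "c' t = (SOME x. \<exists>(J, d)\<in>E. t \<in> J \<and> x = d t)" for t
  have c': "c' t = d t" if "(J, d) \<in> E" "t \<in> J" for J d t
  proof -
    have "\<exists>(J, d)\<in>E. t \<in> J \<and> c' t = d t"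
      unfolding c'_def by (rule someI[of _ "d t"]) (use that in auto)
    then show ?thesis using agree that by (auto split: prod.splits)
  qed
  have IE: "(I, c) \<in> E" using I c by (auto simp: E_def)
  have IU: "I \<subseteq> U" using IE by (force simp: U_def)
  have Uo: "open U" by (auto simp: U_def E_def)
  have "connected U" unfolding U_def
  proof (rule connected_Union)
    show "connected s" if "s \<in> fst ` E" for s
      using that by (auto simp: E_def is_interval_connected_1)
    have "i \<in> \<Inter> (fst ` E)" using i by (auto simp: E_def)
    then show "\<Inter> (fst ` E) \<noteq> {}" by blast
  qed
  have Uc: "integral_curve X M U c'"
    unfolding integral_curve_def
  proof
    fix t assume "t \<in> U"
    then obtain J d where J: "(J, d) \<in> E" "t \<in> J" by (auto simp: U_def)
    have "integral_curve X M J c'"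
      by (rule integral_curve_cong[of _ _ _ d]) (use J c' in \<open>auto simp: E_def\<close>)
    then show "c' t \<in> M \<and> (c' has_vector_derivative X (c' t)) (at t)"
      using J by (auto simp: integral_curve_def)
  qed
  have "U = UNIV"
  proof (rule ccontr)
    assume "U \<noteq> UNIV"
    then have "\<not> closed U" using Uo IU i connected_UNIV unfolding connected_clopen by force
    then obtain b where b: "b \<in> closure U" "b \<notin> U"
      using closure_subset_eq by blast
    obtain l where l: "l \<in> M"
      "\<And>r \<epsilon>. r > 0 \<Longrightarrow> \<epsilon> > 0 \<Longrightarrow> \<exists>t\<in>U. dist t b < \<epsilon> \<and> dist (c' t) l < r"
      using cluster[OF Uo _ Uc b] \<open>connected U\<close> by (auto simp: is_interval_connected_1)
    obtain \<epsilon> r where er: "\<epsilon> > 0" "r > 0"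
      "\<And>t0 z. z \<in> ball l r \<Longrightarrow> \<exists>c. integral_curve X M (ball t0 \<epsilon>) c \<and> c t0 = z"
      using local_flow_exists[OF assms(1,2) l(1)] by metis
    \<comment> \<open>\<open>t1\<close> is closer to \<open>b\<close> than the local existence time,
      so \<open>ball t1 \<epsilon>\<close> contains \<open>b\<close> and the glued curve contradicts
      maximality.\<close>
    obtain t1 where t1: "t1 \<in> U" "dist t1 b < \<epsilon>" "dist (c' t1) l < r"
      using l(2) er by blast
    obtain d where d: "integral_curve X M (ball t1 \<epsilon>) d" "d t1 = c' t1"
      using er(3)[of "c' t1" t1] t1 by (auto simp: dist_commute)
    define e where "e t = (if t \<in> U then c' t else d t)" for t
    have ed: "e t = d t" if "t \<in> ball t1 \<epsilon>" for t
    proof (cases "t \<in> U")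
      case True
      have "c' t = d t"
      proof (rule integral_curve_unique[OF assms(1,2), of "U \<inter> ball t1 \<epsilon>" c' d t1])
        show "is_interval (U \<inter> ball t1 \<epsilon>)"
          using \<open>connected U\<close> by (intro is_interval_Int) (auto simp: is_interval_connected_1)
        show "integral_curve X M (U \<inter> ball t1 \<epsilon>) c'" "integral_curve X M (U \<inter> ball t1 \<epsilon>) d"
          using Uc d(1) by (auto intro: integral_curve_subset)
      qed (use Uo True that t1 d er in auto)
      then show ?thesis using True by (simp add: e_def)
    qed (simp add: e_def)
    have "integral_curve X M U e"
      by (rule integral_curve_cong[OF Uc Uo]) (simp add: e_def)
    moreover have "integral_curve X M (ball t1 \<epsilon>) e"
      by (rule integral_curve_cong[OF d(1)]) (use ed in auto)
    ultimately have "integral_curve X M (U \<union> ball t1 \<epsilon>) e" by (auto simp: integral_curve_def)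
    moreover have "is_interval (U \<union> ball t1 \<epsilon>)"
      unfolding is_interval_connected_1
      by (rule connected_Un) (use \<open>connected U\<close> t1 er in auto)
    moreover have "\<forall>t\<in>I. e t = c t" using IU c'[OF IE] by (auto simp: e_def)
    ultimately have "(U \<union> ball t1 \<epsilon>, e) \<in> E" using Uo IU by (auto simp: E_def)
    then have "U \<union> ball t1 \<epsilon> \<subseteq> U" by (force simp: U_def)
    then show False using b t1 by auto
  qed
  then show "\<exists>c'. integral_curve X M UNIV c' \<and> (\<forall>t\<in>I. c' t = c t)"
    using Uc c'[OF IE] by auto
qed

subsection \<open>Smooth maps\<close>

lemma smooth_on_has_derivative:
  "smooth_on S f \<Longrightarrow> x \<in> S \<Longrightarrow> (f has_derivative frechet_derivative f (at x)) (at x)"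
  unfolding smooth_on_def using Ck_on.simps(2)[of 0 S f] frechet_derivative_works by blast

lemma smooth_on_compose_vector_derivative:
  assumes "smooth_on S f" "(q has_vector_derivative v) (at t)" "q t \<in> S"
  shows "((\<lambda>t. f (q t)) has_vector_derivative frechet_derivative f (at (q t)) v) (at t)"
proof -
  note D = smooth_on_has_derivative[OF assms(1,3)]
  from has_derivative_compose[OF assms(2)[unfolded has_vector_derivative_def] D]
    linear_frechet_derivative[OF differentiableI[OF D]]
  show ?thesis by (simp add: has_vector_derivative_def linear_scale)
qed

lemma smooth_on_frechet_derivative:
  "smooth_on S f \<Longrightarrow> smooth_on S (\<lambda>x. frechet_derivative f (at x) v)"
  unfolding smooth_on_def using Ck_on.simps(2)[of _ S f] by blast

lemma smooth_on_imp_continuous_on: "smooth_on S f \<Longrightarrow> continuous_on S f"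
  unfolding smooth_on_def using Ck_on.simps(1)[of S f] by blast

lemma frechet_derivative_Basis_expansion:
  fixes f :: "'a::euclidean_space \<Rightarrow> 'b::real_normed_vector"
  assumes "f differentiable (at x)"
  shows "frechet_derivative f (at x) v = (\<Sum>b\<in>Basis. (v \<bullet> b) *\<^sub>R frechet_derivative f (at x) b)"
proof -
  have "linear (frechet_derivative f (at x))" using assms by (rule linear_frechet_derivative)
  then show ?thesis
    by (subst (1) euclidean_representation[of v, symmetric])
      (simp add: linear_sum linear_scale)
qed

text \<open>\<open>smooth_on\<close> yields continuity for each fixed direction. Expanding the
  direction in the basis makes the derivative continuous jointly in base point and
  direction.\<close>

lemma continuous_on_frechet_derivative:
  fixes f :: "'a::euclidean_space \<Rightarrow> 'b::real_normed_vector"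
  assumes f: "smooth_on S f" and g: "continuous_on T g" "g ` T \<subseteq> S" and h: "continuous_on T h"
  shows "continuous_on T (\<lambda>x. frechet_derivative f (at (g x)) (h x))"
proof -
  have "continuous_on T (\<lambda>x. \<Sum>b\<in>Basis. (h x \<bullet> b) *\<^sub>R frechet_derivative f (at (g x)) b)"
    by (intro continuous_intros h continuous_on_compose2[OF
          smooth_on_imp_continuous_on[OF smooth_on_frechet_derivative[OF f]] g])
  then show ?thesis
    by (rule continuous_on_eq)
      (use g smooth_on_has_derivative[OF f] in
        \<open>blast intro!: frechet_derivative_Basis_expansion[symmetric] intro: differentiableI\<close>)
qed

lemma smooth_on_imp_loclip_on:
  fixes f :: "'a::euclidean_space \<Rightarrow> 'b::real_normed_vector"
  assumes "open S" "smooth_on S f"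
  shows "loclip_on S f"
  unfolding loclip_on_def
proof
  fix x assume "x \<in> S"
  then obtain r where r: "r > 0" "cball x r \<subseteq> S" using assms(1) open_contains_cball by blast
  define D where "D y v = frechet_derivative f (at y) v" for y v
  have "\<exists>M. \<forall>y\<in>cball x r. norm (D y b) \<le> M" for b
  proof -
    have "continuous_on (cball x r) (\<lambda>y. D y b)"
      using smooth_on_imp_continuous_on[OF smooth_on_frechet_derivative[OF assms(2)]] r(2)
      unfolding D_def by (rule continuous_on_subset)
    then have "bounded ((\<lambda>y. D y b) ` cball x r)"
      by (intro compact_imp_bounded compact_continuous_image) auto
    then show ?thesis by (auto simp: bounded_iff)
  qed
  then obtain M where M: "norm (D y b) \<le> M b" if "y \<in> cball x r" for y b by metis
  \<comment> \<open>Bounds for the finitely many basis directions add up to a bound for the operator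
    norm, since each coordinate is at most \<open>norm v\<close>.\<close>
  define K where "K = (\<Sum>b\<in>(Basis::'a set). M b)"
  have "norm (D y v) \<le> K * norm v" if y: "y \<in> cball x r" for y v
  proof -
    have "D y v = (\<Sum>b\<in>Basis. (v \<bullet> b) *\<^sub>R D y b)"
      unfolding D_def using r y
      by (intro frechet_derivative_Basis_expansion
          differentiableI[OF smooth_on_has_derivative[OF assms(2)]]) auto
    also have "norm \<dots> \<le> (\<Sum>b\<in>Basis. norm v * M b)"
      by (intro sum_norm_le)
        (auto intro!: mult_mono M[OF y] Basis_le_norm)
    also have "\<dots> = K * norm v" by (simp add: K_def sum_distrib_left mult.commute)
    finally show ?thesis .
  qed
  note Dv = this
  have K0: "K \<ge> 0"
  proof -
    have "M b \<ge> 0" for b by (rule order_trans[OF norm_ge_zero M[of x b]]) (use r in auto)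
    then show ?thesis unfolding K_def by (rule sum_nonneg)
  qed
  have "K-lipschitz_on (ball x r \<inter> S) f"
  proof (rule lipschitz_onI[OF _ K0])
    fix y z assume yz: "y \<in> ball x r \<inter> S" "z \<in> ball x r \<inter> S"
    have "norm (f y - f z) \<le> K * norm (y - z)"
    proof (rule differentiable_bound[of "ball x r" f D])
      fix u assume u: "u \<in> ball x r"
      then show "(f has_derivative D u) (at u within ball x r)"
        unfolding D_def using r
        by (auto intro!: has_derivative_at_withinI[OF smooth_on_has_derivative[OF assms(2)]])
      show "onorm (D u) \<le> K"
        by (rule onorm_le) (use u Dv in auto)
    qed (use yz in auto)
    then show "dist (f y) (f z) \<le> K * dist y z" by (simp add: dist_norm)
  qed
  then show "\<exists>r>0. \<exists>K. K-lipschitz_on (ball x r \<inter> S) f" using r by blast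
qed

section \<open>Stability of the local Lipschitz property\<close>

lemma loclip_onI_ball:
  assumes "\<And>x. x \<in> S \<Longrightarrow> \<exists>r>0. \<exists>K. \<forall>y\<in>ball x r \<inter> S. \<forall>z\<in>ball x r \<inter> S.
    dist (f y) (f z) \<le> K * dist y z"
  shows "loclip_on S f"
  unfolding loclip_on_def
proof
  fix x assume "x \<in> S"
  then obtain r K where r: "r > 0" "\<forall>y\<in>ball x r \<inter> S. \<forall>z\<in>ball x r \<inter> S.
    dist (f y) (f z) \<le> K * dist y z" using assms by blast
  have "dist (f y) (f z) \<le> \<bar>K\<bar> * dist y z" if "y \<in> ball x r \<inter> S" "z \<in> ball x r \<inter> S" for y z
  proof -
    have "dist (f y) (f z) \<le> K * dist y z" using r(2) that by blast
    also have "\<dots> \<le> \<bar>K\<bar> * dist y z" by (intro mult_right_mono) auto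
    finally show ?thesis .
  qed
  then show "\<exists>r>0. \<exists>K. K-lipschitz_on (ball x r \<inter> S) f"
    using r(1) by (blast intro: lipschitz_onI abs_ge_zero)
qed

lemma loclip_on_bounded_linear:
  assumes "bounded_linear g"
  shows "loclip_on S g"
proof (rule loclip_onI_ball)
  obtain K where K: "\<And>x. norm (g x) \<le> norm x * K"
    using bounded_linear.bounded[OF assms] by blast
  have "dist (g y) (g z) \<le> K * dist y z" for y z
    using K[of "y - z"]
    by (simp add: dist_norm linear_diff[OF bounded_linear.linear[OF assms]] mult.commute)
  then show "\<exists>r>0. \<exists>K. \<forall>y\<in>ball x r \<inter> S. \<forall>z\<in>ball x r \<inter> S. dist (g y) (g z) \<le> K * dist y z" for x
    using zero_less_one by blast
qed

text \<open>Continuity of \<open>f\<close>, itself a consequence of its being locally Lipschitz,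
  brings its values into a ball on which \<open>g\<close> is Lipschitz.\<close>

lemma loclip_on_compose:
  assumes g: "loclip_on T g" and f: "loclip_on S f" "f ` S \<subseteq> T"
  shows "loclip_on S (\<lambda>x. g (f x))"
  unfolding loclip_on_def
proof
  fix x assume x: "x \<in> S"
  obtain r1 K1 where 1: "r1 > 0" "K1-lipschitz_on (ball (f x) r1 \<inter> T) g"
    using g[unfolded loclip_on_def] f(2) x by blast
  obtain r2 K2 where 2: "r2 > 0" "K2-lipschitz_on (ball x r2 \<inter> S) f"
    using f(1) x by (auto simp: loclip_on_def)
  obtain d where d: "d > 0" "\<And>y. y \<in> S \<Longrightarrow> dist y x < d \<Longrightarrow> dist (f y) (f x) < r1"
    using loclip_on_imp_continuous_on[OF f(1)] x 1(1) unfolding continuous_on_iff by blast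
  have "(K1 * K2)-lipschitz_on (ball x (min r2 d) \<inter> S) (\<lambda>x. g (f x))"
  proof (rule lipschitz_on_compose2[OF lipschitz_on_subset[OF 2(2)] lipschitz_on_subset[OF 1(2)]])
    show "f ` (ball x (min r2 d) \<inter> S) \<subseteq> ball (f x) r1 \<inter> T"
      using d f(2) by (auto simp: dist_commute)
  qed auto
  then show "\<exists>r>0. \<exists>K. K-lipschitz_on (ball x r \<inter> S) (\<lambda>x. g (f x))"
    using 2(1) d(1) by (metis min_less_iff_conj)
qed

lemma loclip_on_Pair:
  assumes "loclip_on S f" "loclip_on S g"
  shows "loclip_on S (\<lambda>x. (f x, g x))"
  unfolding loclip_on_def
proof
  fix x assume x: "x \<in> S"
  obtain r1 K1 where 1: "r1 > 0" "K1-lipschitz_on (ball x r1 \<inter> S) f"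
    using assms(1) x by (auto simp: loclip_on_def)
  obtain r2 K2 where 2: "r2 > 0" "K2-lipschitz_on (ball x r2 \<inter> S) g"
    using assms(2) x by (auto simp: loclip_on_def)
  have "(sqrt (K1\<^sup>2 + K2\<^sup>2))-lipschitz_on (ball x (min r1 r2) \<inter> S) (\<lambda>x. (f x, g x))"
    by (intro lipschitz_on_Pair lipschitz_on_subset[OF 1(2)] lipschitz_on_subset[OF 2(2)]) auto
  then show "\<exists>r>0. \<exists>K. K-lipschitz_on (ball x r \<inter> S) (\<lambda>x. (f x, g x))"
    using 1(1) 2(1) by (metis min_less_iff_conj)
qed

text \<open>After shrinking the ball both factors are bounded, by \<open>F\<close> and
  \<open>G\<close>, and the usual splitting of a difference of products applies.\<close>

lemma loclip_on_bilinear: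
  assumes "bounded_bilinear h" "loclip_on S f" "loclip_on S g"
  shows "loclip_on S (\<lambda>x. h (f x) (g x))"
proof (rule loclip_onI_ball)
  interpret bounded_bilinear h by fact
  fix x assume x: "x \<in> S"
  obtain r1 K1 where 1: "r1 > 0" "K1-lipschitz_on (ball x r1 \<inter> S) f"
    using assms(2) x by (auto simp: loclip_on_def)
  obtain r2 K2 where 2: "r2 > 0" "K2-lipschitz_on (ball x r2 \<inter> S) g"
    using assms(3) x by (auto simp: loclip_on_def)
  have K12: "K1 \<ge> 0" "K2 \<ge> 0" using 1 2 lipschitz_on_nonneg by blast+
  obtain C where C: "C > 0" "\<And>a b. norm (h a b) \<le> norm a * norm b * C"
    using pos_bounded by blast
  define r where "r = min r1 r2"
  define F G where "F = norm (f x) + K1 * r" and "G = norm (g x) + K2 * r"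
  have bnd: "norm (f y) \<le> F" "norm (g y) \<le> G" if "y \<in> ball x r \<inter> S" for y
  proof -
    have "dist (f y) (f x) \<le> K1 * dist y x" "dist (g y) (g x) \<le> K2 * dist y x"
      using that x 1 2 by (auto intro!: lipschitz_onD[OF 1(2)] lipschitz_onD[OF 2(2)] simp: r_def)
    moreover have "K1 * dist y x \<le> K1 * r" "K2 * dist y x \<le> K2 * r"
      using that K12 by (auto intro!: mult_left_mono simp: dist_commute)
    ultimately show "norm (f y) \<le> F" "norm (g y) \<le> G"
      using norm_triangle_sub[of "f y" "f x"] norm_triangle_sub[of "g y" "g x"]
      by (auto simp: F_def G_def dist_norm)
  qed
  have FG: "F \<ge> 0" "G \<ge> 0" using K12 1 2 by (auto simp: F_def G_def r_def)
  have "dist (h (f y) (g y)) (h (f z) (g z)) \<le> ((K1 * G + F * K2) * C) * dist y z"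
    if yz: "y \<in> ball x r \<inter> S" "z \<in> ball x r \<inter> S" for y z
  proof -
    have fg: "norm (f y - f z) \<le> K1 * dist y z" "norm (g y - g z) \<le> K2 * dist y z"
      unfolding dist_norm[symmetric, of "f y"] dist_norm[symmetric, of "g y"]
      using yz by (auto intro!: lipschitz_onD[OF 1(2)] lipschitz_onD[OF 2(2)] simp: r_def)
    have "h (f y) (g y) - h (f z) (g z) = h (f y - f z) (g y) + h (f z) (g y - g z)"
      by (simp add: diff_left diff_right)
    also have "norm \<dots> \<le> norm (f y - f z) * norm (g y) * C + norm (f z) * norm (g y - g z) * C"
      by (intro norm_triangle_le add_mono C)
    also have "\<dots> \<le> (K1 * dist y z) * G * C + F * (K2 * dist y z) * C"
      using C FG K12 by (intro add_mono mult_mono fg bnd yz order_refl) auto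
    finally show ?thesis by (simp add: dist_norm algebra_simps)
  qed
  then show "\<exists>r>0. \<exists>K. \<forall>y\<in>ball x r \<inter> S. \<forall>z\<in>ball x r \<inter> S.
      dist (h (f y) (g y)) (h (f z) (g z)) \<le> K * dist y z"
    using 1(1) 2(1) by (intro exI[of _ r] conjI exI[of _ "(K1 * G + F * K2) * C"]) (auto simp: r_def)
qed

lemma loclip_on_add:
  fixes f g :: "'a::metric_space \<Rightarrow> 'b::real_normed_vector"
  assumes "loclip_on S f" "loclip_on S g"
  shows "loclip_on S (\<lambda>x. f x + g x)"
proof -
  have "loclip_on S (\<lambda>x. fst (f x, g x) + snd (f x, g x))"
  proof (rule loclip_on_compose[where T = UNIV and g = "\<lambda>p. fst p + snd p"])
    show "loclip_on UNIV (\<lambda>p::'b \<times> 'b. fst p + snd p)"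
      by (intro loclip_on_bounded_linear bounded_linear_add bounded_linear_fst bounded_linear_snd)
    show "loclip_on S (\<lambda>x. (f x, g x))" using assms by (rule loclip_on_Pair)
  qed auto
  then show ?thesis by simp
qed

lemma loclip_on_bounded_linear_compose:
  "bounded_linear g \<Longrightarrow> loclip_on S f \<Longrightarrow> loclip_on S (\<lambda>x. g (f x))"
  by (rule loclip_on_compose[OF loclip_on_bounded_linear[of g UNIV]]) auto

lemma loclip_on_sum:
  fixes f :: "'i \<Rightarrow> 'a::metric_space \<Rightarrow> 'b::real_normed_vector"
  assumes "finite I" "\<And>i. i \<in> I \<Longrightarrow> loclip_on S (f i)"
  shows "loclip_on S (\<lambda>x. \<Sum>i\<in>I. f i x)"
  using assms
proof (induction I rule: finite_induct)
  case empty
  have "0-lipschitz_on T (\<lambda>x. 0::'b)" for T :: "'a set" by (auto intro: lipschitz_onI)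
  then show ?case by (auto simp: loclip_on_def intro: zero_less_one)
qed (auto intro!: loclip_on_add)

subsection \<open>The magnetic Hamiltonian vector field\<close>

text \<open>The index raising isomorphism of the Euclidean metric, inverse to
  \<open>blinfun_inner_right\<close>.\<close>

definition sharp :: "('a::euclidean_space \<Rightarrow>\<^sub>L real) \<Rightarrow> 'a" where
  "sharp p = (\<Sum>b\<in>Basis. blinfun_apply p b *\<^sub>R b)"

lemma inner_sharp: "sharp p \<bullet> v = blinfun_apply p v"
proof -
  have "sharp p \<bullet> v = (\<Sum>b\<in>Basis. blinfun_apply p b * (b \<bullet> v))"
    by (simp add: sharp_def inner_sum_left)
  also have "\<dots> = blinfun_apply p (\<Sum>b\<in>Basis. (v \<bullet> b) *\<^sub>R b)"
    by (simp add: blinfun.sum_right blinfun.scaleR_right inner_commute mult.commute)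
  finally show ?thesis by (simp add: euclidean_representation)
qed

lemma norm_sharp: "norm (sharp p) = norm p"
proof (rule antisym)
  have "norm (sharp p) * norm (sharp p) \<le> norm p * norm (sharp p)"
    using norm_blinfun[of p "sharp p"] inner_sharp[of p "sharp p"]
    by (simp add: power2_norm_eq_inner[symmetric] power2_eq_square)
  then show "norm (sharp p) \<le> norm p"
    by (cases "sharp p = 0") auto
  show "norm p \<le> norm (sharp p)"
    by (rule norm_blinfun_bound) (auto simp flip: inner_sharp intro: Cauchy_Schwarz_ineq2)
qed

lemma bounded_linear_sharp: "bounded_linear sharp"
  unfolding sharp_def by (intro bounded_linear_sum bounded_linear_scaleR_const
      bounded_linear_blinfun_apply bounded_linear_ident blinfun.bounded_linear_left)

lemma inner_right_sharp: "blinfun_inner_right (sharp p) = p"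
  by (rule blinfun_eqI) (simp add: inner_sharp)

text \<open>Testing against purely vertical and purely horizontal vectors separates the two
  components. This uniqueness gives the \<open>THE\<close> in
  \<open>hamiltonian_vector_field\<close> its meaning.\<close>

lemma canonical_symplectic_nondegenerate:
  assumes "\<And>Y. canonical_symplectic X Y = canonical_symplectic X' Y"
  shows "X = X'"
proof (rule prod_eqI)
  show "fst X = fst X'"
    by (rule vector_eq_ldot[THEN iffD1])
      (use assms[of "(0, blinfun_inner_right _)"] in \<open>simp add: canonical_symplectic_def\<close>)
  show "snd X = snd X'"
    by (rule blinfun_eqI) (use assms[of "(_, 0)"] in \<open>simp add: canonical_symplectic_def\<close>)
qed

section \<open>Hamilton's equations and the Lorentz force\<close>

definition velocity :: "real \<Rightarrow> real \<Rightarrow> (plane \<Rightarrow> covector) \<Rightarrow> plane \<times> covector \<Rightarrow> plane" where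
  "velocity m e A z = (1 / m) *\<^sub>R sharp (snd z - e *\<^sub>R A (fst z))"

text \<open>Not the 2-form \<open>B\<close>, but the Hamiltonian vector field on phase space in
  closed form. The second component is the covector \<open>w \<mapsto> e (D_w A)(velocity)\<close>,
  that is \<open>-\<partial>H/\<partial>q\<close>, spelled out in the basis because
  \<open>frechet_derivative\<close> is a plain function and each summand is visibly locally
  Lipschitz.\<close>

definition magnetic_field :: "real \<Rightarrow> real \<Rightarrow> (plane \<Rightarrow> covector) \<Rightarrow> plane \<times> covector \<Rightarrow> plane \<times> covector"
  where
  "magnetic_field m e A z = (velocity m e A z,
     \<Sum>b\<in>Basis. (e * blinfun_apply (frechet_derivative A (at (fst z)) b) (velocity m e A z)) *\<^sub>R
       blinfun_inner_right b)"

lemma apply_sum_inner_right: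
  fixes f :: "'a::euclidean_space \<Rightarrow> real"
  assumes "linear f"
  shows "blinfun_apply (\<Sum>b\<in>Basis. f b *\<^sub>R blinfun_inner_right b) w = f w"
proof -
  have "f w = f (\<Sum>b\<in>Basis. (w \<bullet> b) *\<^sub>R b)" by (simp add: euclidean_representation)
  also have "\<dots> = (\<Sum>b\<in>Basis. (w \<bullet> b) * f b)"
    using assms by (simp add: linear_sum linear_scale)
  finally show ?thesis
    by (simp add: blinfun.sum_left blinfun.scaleR_left inner_commute mult.commute)
qed

lemma apply_snd_magnetic_field:
  assumes "A differentiable (at (fst z))"
  shows "blinfun_apply (snd (magnetic_field m e A z)) w =
    e * blinfun_apply (frechet_derivative A (at (fst z)) w) (velocity m e A z)"
proof -
  have "linear (\<lambda>b. e * blinfun_apply (frechet_derivative A (at (fst z)) b) (velocity m e A z))"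
    using linear_frechet_derivative[OF assms]
    by (intro linearI)
      (simp_all add: linear_add linear_scale blinfun.add_left blinfun.scaleR_left algebra_simps)
  then show ?thesis unfolding magnetic_field_def snd_conv by (rule apply_sum_inner_right)
qed

lemma has_derivative_compose_fst:
  assumes "(A has_derivative D) (at (fst z))"
  shows "((\<lambda>z. A (fst z)) has_derivative (\<lambda>Y. D (fst Y))) (at z)"
  using has_derivative_compose[OF has_derivative_fst[OF has_derivative_ident] assms] by simp

lemma magnetic_hamiltonian_has_derivative:
  assumes "m \<noteq> 0" "A differentiable (at (fst z))"
  shows "(magnetic_hamiltonian m e A has_derivative
     canonical_symplectic (magnetic_field m e A z)) (at z)"
proof -
  let ?D = "frechet_derivative A (at (fst z))"
  have D: "(A has_derivative ?D) (at (fst z))" using assms(2) by (simp add: frechet_derivative_works)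
  note A = has_derivative_compose_fst[OF D]
  have 1: "((\<lambda>z. sharp (snd z - e *\<^sub>R A (fst z))) has_derivative
      (\<lambda>Y. sharp (snd Y - e *\<^sub>R ?D (fst Y)))) (at z)"
    by (intro bounded_linear.has_derivative[OF bounded_linear_sharp] derivative_intros A)
  \<comment> \<open>Transporting the dual norm to the plane turns \<open>H\<close> into an inner
    product, to which the product rule applies.\<close>
  have 2: "magnetic_hamiltonian m e A =
     (\<lambda>z. (1 / (2 * m)) * (sharp (snd z - e *\<^sub>R A (fst z)) \<bullet> sharp (snd z - e *\<^sub>R A (fst z))))"
    by (auto simp: magnetic_hamiltonian_def fun_eq_iff dot_square_norm norm_sharp)
  have 3: "sharp (snd z - e *\<^sub>R A (fst z)) = m *\<^sub>R velocity m e A z"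
    using assms(1) by (simp add: velocity_def)
  have 4: "fst (magnetic_field m e A z) = velocity m e A z" by (simp add: magnetic_field_def)
  show ?thesis unfolding 2
    by (rule has_derivative_eq_rhs[OF has_derivative_mult_right[OF has_derivative_inner[OF 1 1]]])
      (use assms(1) in \<open>auto simp: fun_eq_iff canonical_symplectic_def 3 4 inner_sharp
        apply_snd_magnetic_field[OF assms(2)] inner_commute[of "velocity m e A z"]
        blinfun.diff_left blinfun.scaleR_left\<close>)
qed

lemma hamiltonian_vector_field_magnetic:
  assumes "m \<noteq> 0" "A differentiable (at (fst z))"
  shows "hamiltonian_vector_field (magnetic_hamiltonian m e A) z = magnetic_field m e A z"
  unfolding hamiltonian_vector_field_def
    frechet_derivative_at[OF magnetic_hamiltonian_has_derivative[OF assms], symmetric]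
  by (rule the_equality) (auto intro: canonical_symplectic_nondegenerate)

lemma loclip_on_magnetic_field:
  assumes "open \<Omega>" "smooth_on \<Omega> A"
  shows "loclip_on (\<Omega> \<times> UNIV) (magnetic_field m e A)"
proof -
  have fst: "loclip_on (\<Omega> \<times> (UNIV :: covector set)) (\<lambda>z. f (fst z))"
    if "smooth_on \<Omega> f" for f :: "plane \<Rightarrow> covector"
    by (rule loclip_on_compose[OF smooth_on_imp_loclip_on[OF assms(1) that], where f = fst])
      (auto intro: loclip_on_bounded_linear[OF bounded_linear_fst])
  have vel: "loclip_on (\<Omega> \<times> UNIV) (velocity m e A)"
  proof -
    have "loclip_on (\<Omega> \<times> UNIV) (\<lambda>z. snd z + (- e) *\<^sub>R A (fst z))"
      by (intro loclip_on_add loclip_on_bounded_linear[OF bounded_linear_snd]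
          loclip_on_bounded_linear_compose[OF bounded_linear_scaleR_right] fst assms(2))
    from loclip_on_bounded_linear_compose[OF bounded_linear_scaleR_right
        loclip_on_bounded_linear_compose[OF bounded_linear_sharp this], of "1 / m"]
    show ?thesis by (simp add: velocity_def[abs_def])
  qed
  have D: "loclip_on (\<Omega> \<times> UNIV)
      (\<lambda>z. blinfun_apply (frechet_derivative A (at (fst z)) b) (velocity m e A z))" for b
    by (intro loclip_on_bilinear[OF bounded_bilinear_blinfun_apply] vel
        fst[OF smooth_on_frechet_derivative[OF assms(2)]])
  have "loclip_on (\<Omega> \<times> UNIV) (\<lambda>z. (e * blinfun_apply (frechet_derivative A (at (fst z)) b)
     (velocity m e A z)) *\<^sub>R (blinfun_inner_right b :: covector))" for b
    by (rule loclip_on_bounded_linear_compose[OF bounded_linear_scaleR_left]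
          loclip_on_bounded_linear_compose[OF bounded_linear_mult_right] D)+
  then show ?thesis
    unfolding magnetic_field_def[abs_def]
    by (intro loclip_on_Pair vel loclip_on_sum) auto
qed

text \<open>Passing from momentum to velocity subtracts \<open>e\<close> times the derivative of
  \<open>A\<close> along the curve; together with \<open>-\<partial>H/\<partial>q\<close> this
  antisymmetrizes to \<open>dA\<close>. In the resulting Lorentz force law the gauge is no longer
  visible.\<close>

lemma magnetic_newton:
  assumes "m \<noteq> 0" "smooth_on \<Omega> A" "integral_curve (magnetic_field m e A) (\<Omega> \<times> UNIV) I c" "t \<in> I"
  shows "((\<lambda>t. fst (c t)) has_vector_derivative velocity m e A (c t)) (at t)"
    and "\<exists>a. ((\<lambda>t. velocity m e A (c t)) has_vector_derivative a) (at t) \<and>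
      (\<forall>w. m * (a \<bullet> w) = e * ext_deriv A (fst (c t)) w (velocity m e A (c t)))"
proof -
  let ?v = "velocity m e A (c t)" and ?D = "frechet_derivative A (at (fst (c t)))"
  have q: "fst (c t) \<in> \<Omega>" and c: "(c has_vector_derivative magnetic_field m e A (c t)) (at t)"
    using assms(3,4) by (auto simp: integral_curve_def mem_Times_iff)
  have D: "(A has_derivative ?D) (at (fst (c t)))" by (rule smooth_on_has_derivative[OF assms(2) q])
  then have dA: "A differentiable (at (fst (c t)))" by (rule differentiableI)
  have 1: "((\<lambda>t. fst (c t)) has_vector_derivative fst (magnetic_field m e A (c t))) (at t)"
    using bounded_linear.has_vector_derivative[OF bounded_linear_fst c] .
  then show q': "((\<lambda>t. fst (c t)) has_vector_derivative ?v) (at t)"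
    by (simp add: magnetic_field_def)
  have 2: "((\<lambda>t. snd (c t)) has_vector_derivative snd (magnetic_field m e A (c t))) (at t)"
    using bounded_linear.has_vector_derivative[OF bounded_linear_snd c] .
  have 3: "((\<lambda>t. A (fst (c t))) has_vector_derivative ?D ?v) (at t)"
    using assms(2) q' q by (rule smooth_on_compose_vector_derivative)
  let ?p = "snd (magnetic_field m e A (c t)) - e *\<^sub>R ?D ?v"
  have 4: "((\<lambda>t. velocity m e A (c t)) has_vector_derivative (1 / m) *\<^sub>R sharp ?p) (at t)"
    unfolding velocity_def
    by (rule bounded_linear.has_vector_derivative[OF bounded_linear_scaleR_right]
        bounded_linear.has_vector_derivative[OF bounded_linear_sharp]
        has_vector_derivative_diff 2 3[unfolded velocity_def])+
  have "m * (((1 / m) *\<^sub>R sharp ?p) \<bullet> w) = e * ext_deriv A (fst (c t)) w ?v" for w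
    using assms(1) by (simp add: inner_sharp blinfun.diff_left blinfun.scaleR_left
        apply_snd_magnetic_field[OF dA] ext_deriv_def algebra_simps)
  then show "\<exists>a. ((\<lambda>t. velocity m e A (c t)) has_vector_derivative a) (at t) \<and>
      (\<forall>w. m * (a \<bullet> w) = e * ext_deriv A (fst (c t)) w ?v)"
    using 4 by blast
qed

subsection \<open>Normal coordinates near the boundary\<close>

text \<open>In the plane \<open>w\<close> is plus or minus the quarter turn of \<open>u\<close>, the
  sign being the determinant \<open>D\<close>; so orthonormality of the columns \<open>u\<close>,
  \<open>w\<close> passes to the rows.\<close>

lemma orthonormal_expansion_plane:
  fixes u w v :: plane
  assumes "norm u = 1" "norm w = 1" "u \<bullet> w = 0"
  shows "v = (v \<bullet> u) *\<^sub>R u + (v \<bullet> w) *\<^sub>R w"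
proof -
  define a b c d where "a = u $ 1" "b = u $ 2" "c = w $ 1" "d = w $ 2"
  have 1: "a\<^sup>2 + b\<^sup>2 = 1" "c\<^sup>2 + d\<^sup>2 = 1" "a * c + b * d = 0"
    using assms by (auto simp: norm_eq_1 inner_vec_def sum_2 a_b_c_d_def power2_eq_square)
  define D where "D = a * d - b * c"
  have "c * (a\<^sup>2 + b\<^sup>2) = - b * D + a * (a * c + b * d)" "d * (a\<^sup>2 + b\<^sup>2) = a * D + b * (a * c + b * d)"
    by (auto simp: D_def power2_eq_square algebra_simps)
  then have cd: "c = - b * D" "d = a * D" unfolding 1 by simp_all
  have "D\<^sup>2 * (a\<^sup>2 + b\<^sup>2) = 1" using 1(2) unfolding cd by (simp add: algebra_simps power2_eq_square)
  then have D: "D * D = 1" using 1 by (simp add: power2_eq_square)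
  have e: "a * a + c * c = 1" "b * b + d * d = 1" "a * b + c * d = 0"
  proof -
    have "a * a + c * c = a * a + b * b * (D * D)" "b * b + d * d = b * b + a * a * (D * D)"
      "a * b + c * d = a * b - a * b * (D * D)"
      unfolding cd by (auto simp: algebra_simps)
    then show "a * a + c * c = 1" "b * b + d * d = 1" "a * b + c * d = 0"
      using 1(1) D by (auto simp: power2_eq_square)
  qed
  have "(v \<bullet> u) * a + (v \<bullet> w) * c = v $ 1 * (a * a + c * c) + v $ 2 * (a * b + c * d)"
    "(v \<bullet> u) * b + (v \<bullet> w) * d = v $ 1 * (a * b + c * d) + v $ 2 * (b * b + d * d)"
    by (auto simp: inner_vec_def sum_2 a_b_c_d_def algebra_simps)
  then show ?thesis by (simp add: vec_eq_iff forall_2 e flip: a_b_c_d_def)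
qed

text \<open>What the estimates use of a boundary component: \<open>\<gamma>\<close> and
  \<open>\<nu>\<close> are twice continuously differentiable, with named derivatives. Hence the
  normal map makes sense, with the same regularity, for \<open>n \<le> 0\<close> too.\<close>

locale collar =
  fixes \<Omega> :: "plane set" and \<gamma> \<gamma>1 \<gamma>2 \<nu> \<nu>1 \<nu>2 :: "real \<Rightarrow> plane" and N N' :: real
  assumes \<gamma>: "(\<gamma> has_vector_derivative \<gamma>1 s) (at s)"
    and \<gamma>1: "(\<gamma>1 has_vector_derivative \<gamma>2 s) (at s)"
    and \<nu>: "(\<nu> has_vector_derivative \<nu>1 s) (at s)"
    and \<nu>1: "(\<nu>1 has_vector_derivative \<nu>2 s) (at s)"
    and \<gamma>2: "continuous_on UNIV \<gamma>2" and \<nu>2: "continuous_on UNIV \<nu>2"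
    and unit: "norm (\<gamma>1 s) = 1" "norm (\<nu> s) = 1" "\<nu> s \<bullet> \<gamma>1 s = 0"
    and inward: "\<forall>\<^sub>F n in at_right 0. \<gamma> s + n *\<^sub>R \<nu> s \<in> \<Omega>"
    and frontier: "\<gamma> s \<in> frontier \<Omega>"
    and \<Omega>: "open \<Omega>"
    and N: "0 < N" "N < N'"
    and subset: "0 < n \<Longrightarrow> n < N' \<Longrightarrow> \<gamma> s + n *\<^sub>R \<nu> s \<in> \<Omega>"
begin

definition F where "F n s = \<gamma> s + n *\<^sub>R \<nu> s"

definition Fs where "Fs n s = \<gamma>1 s + n *\<^sub>R \<nu>1 s"

lemma continuous_on_of_derivative:
  "(\<And>s. (f has_vector_derivative f' s) (at s)) \<Longrightarrow> continuous_on UNIV f"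
  by (rule continuous_on_vector_derivative) simp

lemmas cont = continuous_on_of_derivative[OF \<gamma>] continuous_on_of_derivative[OF \<gamma>1]
  continuous_on_of_derivative[OF \<nu>] continuous_on_of_derivative[OF \<nu>1] \<gamma>2 \<nu>2

lemmas cont_compose = cont[THEN continuous_on_compose2, OF _ subset_UNIV]

lemma cont_F: "continuous_on T f \<Longrightarrow> continuous_on T g \<Longrightarrow> continuous_on T (\<lambda>x. F (f x) (g x))"
  unfolding F_def by (intro continuous_intros cont_compose)

lemma cont_Fs: "continuous_on T f \<Longrightarrow> continuous_on T g \<Longrightarrow> continuous_on T (\<lambda>x. Fs (f x) (g x))"
  unfolding Fs_def by (intro continuous_intros cont_compose)

lemma F_vd: "((\<lambda>s. F n s) has_vector_derivative Fs n s) (at s)"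
  unfolding F_def Fs_def by (auto intro!: derivative_eq_intros \<gamma> \<nu>)

lemma Fs_vd: "((\<lambda>s. Fs n s) has_vector_derivative \<gamma>2 s + n *\<^sub>R \<nu>2 s) (at s)"
  unfolding Fs_def by (auto intro!: derivative_eq_intros \<gamma>1 \<nu>1)

section \<open>Orthogonality of the coordinate lines and the two sides of the boundary\<close>

lemma \<nu>_\<nu>1: "\<nu> s \<bullet> \<nu>1 s = 0"
proof -
  have "((\<lambda>s. \<nu> s \<bullet> \<nu> s) has_derivative (\<lambda>h. \<nu> s \<bullet> (h *\<^sub>R \<nu>1 s) + (h *\<^sub>R \<nu>1 s) \<bullet> \<nu> s)) (at s)"
    using \<nu> unfolding has_vector_derivative_def by (intro has_derivative_inner)
  moreover have "(\<lambda>s. \<nu> s \<bullet> \<nu> s) = (\<lambda>_. 1)" using unit by (auto simp: norm_eq_1)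
  ultimately have "((\<lambda>s::real. 1::real) has_derivative (\<lambda>h. \<nu> s \<bullet> (h *\<^sub>R \<nu>1 s) + (h *\<^sub>R \<nu>1 s) \<bullet> \<nu> s)) (at s)"
    by simp
  from fun_cong[OF has_derivative_unique[OF this has_derivative_const], of 1]
  have "\<nu> s \<bullet> (1 *\<^sub>R \<nu>1 s) + (1 *\<^sub>R \<nu>1 s) \<bullet> \<nu> s = 0" .
  then show ?thesis by (simp add: inner_commute)
qed

text \<open>Gauss lemma: normal lines meet all parallel curves at right angles. The metric is thus
  diagonal in \<open>(n, s)\<close>, and velocity components are read off by inner products.\<close>

lemma \<nu>_Fs: "\<nu> s \<bullet> Fs n s = 0"
  by (simp add: Fs_def inner_add_right unit \<nu>_\<nu>1)

text \<open>A defining function \<open>f\<close> of \<open>\<Omega>\<close> has positive derivative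
  along \<open>\<nu>\<close> at \<open>\<gamma> s0\<close>, hence nearby; going backwards along a
  normal line from the boundary, where \<open>f \<le> 0\<close>, it stays nonpositive.\<close>

lemma outside_one_side:
  assumes "smooth_boundary \<Omega>"
  obtains \<delta> where "\<delta> > 0" "\<And>n s. -\<delta> < n \<Longrightarrow> n \<le> 0 \<Longrightarrow> \<bar>s - s0\<bar> < \<delta> \<Longrightarrow> F n s \<notin> \<Omega>"
proof -
  obtain U and f :: "plane \<Rightarrow> real" where Uf: "open U \<and> \<gamma> s0 \<in> U \<and> smooth_on U f \<and>
      (\<forall>x\<in>U. frechet_derivative f (at x) \<noteq> (\<lambda>v. 0)) \<and> \<Omega> \<inter> U = {x \<in> U. f x > 0}"
    using bspec[OF assms[unfolded smooth_boundary_def] frontier[of s0]] by (elim exE)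
  then have U: "open U" "\<gamma> s0 \<in> U" "smooth_on U f"
    "\<And>x. x \<in> U \<Longrightarrow> frechet_derivative f (at x) \<noteq> (\<lambda>v. 0)"
    "\<Omega> \<inter> U = {x \<in> U. f x > 0}"
    by simp_all
  have notin: "\<gamma> s \<notin> \<Omega>" for s using frontier[of s] \<Omega> by (simp add: frontier_def interior_open)
  then have le0: "f (\<gamma> s) \<le> 0" if "\<gamma> s \<in> U" for s using U(5) that by force
  have fc: "continuous_on U f" using U(3) by (rule smooth_on_imp_continuous_on)
  \<comment> \<open>Points of \<open>\<Omega>\<close>, where \<open>f > 0\<close>, accumulate at
    \<open>\<gamma> s0\<close>, so \<open>f\<close> cannot be negative there.\<close>
  have f0: "f (\<gamma> s0) = 0"
  proof (rule ccontr)
    assume "f (\<gamma> s0) \<noteq> 0"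
    then have neg: "f (\<gamma> s0) < 0" using le0 U(2) by fastforce
    have "open (U \<inter> f -` {..<0})" by (rule continuous_open_preimage[OF fc U(1)]) simp
    moreover have "\<gamma> s0 \<in> U \<inter> f -` {..<0}" using neg U by simp
    moreover have "\<gamma> s0 \<in> closure \<Omega>" using frontier[of s0] by (simp add: frontier_def)
    ultimately have "(U \<inter> f -` {..<0}) \<inter> \<Omega> \<noteq> {}"
      using open_Int_closure_eq_empty[of "U \<inter> f -` {..<0}" \<Omega>] by blast
    then show False using U(5) by force
  qed
  define D where "D x = frechet_derivative f (at x)" for x
  have Df: "((\<lambda>t. f (h t)) has_real_derivative D (h t) h') (at t)"
    if "(h has_vector_derivative h') (at t)" "h t \<in> U" for h h' and t :: real
    using smooth_on_compose_vector_derivative[OF U(3) that]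
    by (simp add: D_def has_real_derivative_iff_has_vector_derivative)
  have Dlin: "linear (D x)" if "x \<in> U" for x
    unfolding D_def using smooth_on_has_derivative[OF U(3) that]
    by (intro linear_frechet_derivative differentiableI)
  \<comment> \<open>\<open>f\<close> is nonpositive along \<open>\<gamma>\<close> and vanishes at
    \<open>s0\<close>, which is therefore a local maximum.\<close>
  have Dtan: "D (\<gamma> s0) (\<gamma>1 s0) = 0"
  proof -
    have "open (\<gamma> -` U)" using cont(1) U(1) by (rule open_vimage[rotated])
    then obtain d where d: "d > 0" "ball s0 d \<subseteq> \<gamma> -` U" using U(2) open_contains_ball by blast
    have "\<forall>y. \<bar>s0 - y\<bar> < d \<longrightarrow> f (\<gamma> y) \<le> f (\<gamma> s0)"
      using d le0 f0 by (auto simp: subset_iff dist_real_def)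
    with DERIV_local_max[OF Df[OF \<gamma> U(2)] d(1)] show ?thesis by blast
  qed
  have Fvdn: "((\<lambda>u. F u s) has_vector_derivative \<nu> s) (at n)" for n s
    unfolding F_def by (auto intro!: derivative_eq_intros)
  have F0: "F 0 s = \<gamma> s" for s by (simp add: F_def)
  \<comment> \<open>A zero normal derivative would, with \<open>Dtan\<close>, make
    \<open>\<gamma> s0\<close> a critical point; a negative one would make \<open>f\<close> negative
    on the inward segment, which starts inside \<open>\<Omega>\<close>.\<close>
  have Dnor: "D (\<gamma> s0) (\<nu> s0) > 0"
  proof (rule ccontr)
    let ?k = "D (\<gamma> s0) (\<nu> s0)"
    assume nk: "\<not> ?k > 0"
    show False
    proof (cases "?k = 0")
      case True
      have "D (\<gamma> s0) v = 0" for v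
        by (subst orthonormal_expansion_plane[OF unit(2,1,3), of v s0])
          (simp add: linear_add[OF Dlin[OF U(2)]] linear_scale[OF Dlin[OF U(2)]] True Dtan)
      then show False using U(4)[OF U(2)] by (auto simp: D_def)
    next
      case False
      then have "?k < 0" using nk by simp
      moreover have "((\<lambda>u. f (F u s0)) has_real_derivative ?k) (at 0)"
        using Df[OF Fvdn[where n = 0 and s = s0]] U(2) by (simp add: F0)
      ultimately obtain d where d: "d > 0" "\<And>h. 0 < h \<Longrightarrow> h < d \<Longrightarrow> f (F h s0) < f (F 0 s0)"
        using DERIV_neg_dec_right[of "\<lambda>u. f (F u s0)" ?k 0] by auto
      have "continuous_on UNIV (\<lambda>u. F u s0)" by (intro cont_F continuous_intros)
      then have "open ((\<lambda>u. F u s0) -` U)" using U(1) by (rule open_vimage[rotated])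
      then have "\<forall>\<^sub>F u in nhds 0. u \<in> (\<lambda>u. F u s0) -` U"
        using U(2) by (intro eventually_nhds_in_open) (auto simp: F0)
      then have "\<forall>\<^sub>F u in at_right 0. F u s0 \<in> U"
        by (auto intro: filter_leD[OF at_within_le_nhds] elim: eventually_mono)
      moreover have "\<forall>\<^sub>F u in at_right 0. F u s0 \<in> \<Omega>" unfolding F_def by (rule inward)
      moreover have "\<forall>\<^sub>F u in at_right 0. u \<in> {0<..<d}"
        using d(1) by (rule eventually_at_right_real)
      ultimately have "\<forall>\<^sub>F u::real in at_right 0. False"
      proof eventually_elim
        case (elim u)
        then have "f (F u s0) > 0" using U(5) by blast
        then show False using d(2)[of u] elim f0 by (simp add: F0)
      qed
      then show False by simp
    qed
  qed
  define W where "W = (\<lambda>p. F (fst p) (snd p)) -` U"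
  have W: "open W"
    unfolding W_def using U(1) by (rule open_vimage) (auto intro!: cont_F continuous_intros)
  define W' where "W' = W \<inter> (\<lambda>p. D (F (fst p) (snd p)) (\<nu> (snd p))) -` {0<..}"
  have "open W'"
    unfolding W'_def D_def
    by (rule continuous_open_preimage[OF continuous_on_frechet_derivative[OF U(3)] W])
      (auto intro!: cont_F continuous_intros cont_compose simp: W_def)
  moreover have "(0, s0) \<in> W'" using U(2) Dnor by (simp add: W'_def W_def F0)
  ultimately obtain P Q where PQ: "open P" "open Q" "0 \<in> P" "s0 \<in> Q" "P \<times> Q \<subseteq> W'"
    by (elim open_prod_elim) auto
  obtain d1 where d1: "d1 > 0" "ball 0 d1 \<subseteq> P" using PQ open_contains_ball by blast
  obtain d2 where d2: "d2 > 0" "ball s0 d2 \<subseteq> Q" using PQ open_contains_ball by blast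
  have in_W': "(n, s) \<in> W'" if "\<bar>n\<bar> < min d1 d2" "\<bar>s - s0\<bar> < min d1 d2" for n s
  proof -
    have "n \<in> P" "s \<in> Q" using that d1(2) d2(2) by (auto simp: subset_iff dist_real_def)
    then show ?thesis using PQ(5) by blast
  qed
  show ?thesis
  proof
    show "min d1 d2 > 0" using d1 d2 by simp
    fix n s assume ns: "- min d1 d2 < n" "n \<le> 0" "\<bar>s - s0\<bar> < min d1 d2"
    have inW': "(u, s) \<in> W'" if "n \<le> u" "u \<le> 0" for u
      using that ns by (intro in_W') linarith+
    have "f (F n s) \<le> f (F 0 s)"
    proof (rule DERIV_nonneg_imp_nondecreasing[OF ns(2)])
      fix u assume "n \<le> u" "u \<le> 0"
      with inW' have "(u, s) \<in> W'" by blast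
      then have "F u s \<in> U" "D (F u s) (\<nu> s) > 0" by (auto simp: W'_def W_def)
      with Df[OF Fvdn, of u s] show "\<exists>y. ((\<lambda>n. f (F n s)) has_real_derivative y) (at u) \<and> 0 \<le> y"
        by (meson less_imp_le)
    qed
    also have "\<dots> \<le> 0" using inW'[of 0] ns le0 by (simp add: F0 W'_def W_def)
    finally have "F n s \<notin> \<Omega> \<inter> U" unfolding U(5) by auto
    then show "F n s \<notin> \<Omega>" using inW'[of n] ns by (auto simp: W'_def W_def)
  qed
qed

text \<open>The inverse function theorem at \<open>n = 0\<close> gives coordinates on a full
  neighbourhood of the boundary point. A path in \<open>\<Omega>\<close> converging to
  \<open>\<gamma> s0\<close> eventually lies in it, with \<open>n > 0\<close> and \<open>n\<close>
  tending to 0.\<close>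

lemma normal_coordinates_at_boundary:
  assumes "smooth_boundary \<Omega>"
  obtains V n s n' s' where "open V" "\<gamma> s0 \<in> V"
    "\<And>y. y \<in> V \<Longrightarrow> F (n y) (s y) = y"
    "\<And>y. y \<in> V \<Longrightarrow> (n has_derivative n' y) (at y)"
    "\<And>y. y \<in> V \<Longrightarrow> (s has_derivative s' y) (at y)"
    "n (\<gamma> s0) = (0::real)"
    "\<And>y. y \<in> V \<Longrightarrow> n y < N" "\<And>y. y \<in> V \<Longrightarrow> \<bar>s y - s0\<bar> \<le> 1"
    "\<And>y. y \<in> V \<Longrightarrow> norm (Fs (n y) (s y)) \<ge> 1 / 2"
    "\<And>y. y \<in> V \<Longrightarrow> y \<in> \<Omega> \<Longrightarrow> n y > 0"
proof -
  obtain \<delta> where \<delta>: "\<delta> > 0" "\<And>n s. -\<delta> < n \<Longrightarrow> n \<le> 0 \<Longrightarrow> \<bar>s - s0\<bar> < \<delta> \<Longrightarrow> F n s \<notin> \<Omega>"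
    using outside_one_side[OF assms, of s0] by blast
  \<comment> \<open>The pair \<open>(n, s)\<close> is stored as a vector, \<open>n\<close> first, so
    that the map to be inverted goes from the plane to itself.\<close>
  define f where "f y = F (y $ 1) (y $ 2)" for y :: plane
  define D where "D y = (\<lambda>h::plane. (h $ 2) *\<^sub>R Fs (y $ 1) (y $ 2) + (h $ 1) *\<^sub>R \<nu> (y $ 2))" for y :: plane
  define f' where "f' y = Blinfun (D y)" for y
  have bl: "bounded_linear (D y)" for y unfolding D_def
    by (intro bounded_linear_add bounded_linear_scaleR_const bounded_linear_vec_nth)
  have f'D: "blinfun_apply (f' y) = D y" for y
    unfolding f'_def by (rule bounded_linear_Blinfun_apply[OF bl])
  define x0 :: plane where "x0 = vector [0, s0]"
  \<comment> \<open>Each constraint supplies a conclusion: \<open>\<delta>\<close> the positivity of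
    \<open>n\<close> in \<open>\<Omega>\<close>, \<open>N\<close> and 1 the ranges of
    \<open>n\<close> and \<open>s\<close>, the last one the lower bound on \<open>Fs\<close>, whose
    length is 1 at \<open>n = 0\<close>.\<close>
  define U where "U = {y::plane. \<bar>y $ 1\<bar> < min \<delta> N} \<inter> {y. \<bar>y $ 2 - s0\<bar> < min \<delta> 1} \<inter>
    {y. 1 / 2 < norm (Fs (y $ 1) (y $ 2))}"
  have nthc: "continuous_on T (\<lambda>y::plane. y $ i)" for i T by (intro continuous_intros)
  have U: "open U" unfolding U_def
    by (intro open_Int open_Collect_less continuous_intros cont_Fs nthc)
  have x0: "x0 \<in> U" using \<delta> N unit by (simp add: U_def x0_def Fs_def)
  have df: "(f has_derivative blinfun_apply (f' y)) (at y)" for y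
  proof -
    have nth: "((\<lambda>y::plane. y $ i) has_derivative (\<lambda>h. h $ i)) (at y)" for i
      by (rule bounded_linear_imp_has_derivative[OF bounded_linear_vec_nth])
    have c: "((\<lambda>y. g (y $ 2)) has_derivative (\<lambda>h. (h $ 2) *\<^sub>R g' (y $ 2))) (at y)"
      if "\<And>s. (g has_vector_derivative g' s) (at s)" for g g' :: "real \<Rightarrow> plane"
      using has_derivative_compose[OF nth that[unfolded has_vector_derivative_def]] .
    show ?thesis unfolding f'D f_def F_def D_def Fs_def
      by (rule has_derivative_eq_rhs, (rule derivative_intros c \<gamma> \<nu> nth)+)
        (auto simp: fun_eq_iff algebra_simps)
  qed
  have cf: "continuous_on U f'"
    by (rule continuous_on_blinfun_componentwise)
      (auto simp: f'D D_def intro!: continuous_intros cont_Fs cont_compose nthc)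
  \<comment> \<open>At \<open>(0, s0)\<close> the derivative sends the standard basis to the
    orthonormal frame \<open>\<nu> s0\<close>, \<open>\<gamma>1 s0\<close>, so its transpose inverts
    it.\<close>
  define inv where "inv = Blinfun (\<lambda>w::plane. (w \<bullet> \<nu> s0) *\<^sub>R axis 1 1 + (w \<bullet> \<gamma>1 s0) *\<^sub>R (axis 2 1 :: plane))"
  have invD: "blinfun_apply inv = (\<lambda>w. (w \<bullet> \<nu> s0) *\<^sub>R axis 1 1 + (w \<bullet> \<gamma>1 s0) *\<^sub>R axis 2 1)"
    unfolding inv_def by (rule bounded_linear_Blinfun_apply)
      (intro bounded_linear_add bounded_linear_scaleR_const bounded_linear_inner_left_comp bounded_linear_ident)
  have inv: "inv o\<^sub>L f' x0 = id_blinfun"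
    by (rule blinfun_eqI)
      (use unit in \<open>auto simp: invD f'D D_def x0_def Fs_def vec_eq_iff forall_2 inner_add_left axis_def
        norm_eq_1 inner_commute[of "\<gamma>1 s0"]\<close>)
  obtain U' V g g' where IFT: "open U'" "U' \<subseteq> U" "x0 \<in> U'" "open V" "f x0 \<in> V" "homeomorphism U' V f g"
     "\<And>y. y \<in> V \<Longrightarrow> (g has_derivative (g' y)) (at y)"
    using inverse_function_theorem[OF U df cf x0 inv] by metis
  have gU: "g y \<in> U" if "y \<in> V" for y using IFT(2,6) that by (auto simp: homeomorphism_def)
  have fg: "f (g y) = y" if "y \<in> V" for y using IFT(6) that by (auto simp: homeomorphism_def)
  have fx0: "f x0 = \<gamma> s0" by (simp add: f_def x0_def F_def)
  show ?thesis
  proof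
    show "open V" "\<gamma> s0 \<in> V" using IFT fx0 by auto
    fix y assume y: "y \<in> V"
    show F: "F (g y $ 1) (g y $ 2) = y" using fg[OF y] by (simp add: f_def)
    show "((\<lambda>y. g y $ 1) has_derivative (\<lambda>h. g' y h $ 1)) (at y)"
      "((\<lambda>y. g y $ 2) has_derivative (\<lambda>h. g' y h $ 2)) (at y)"
      using bounded_linear.has_derivative[OF bounded_linear_vec_nth IFT(7)[OF y]] by auto
    show "g y $ 1 < N" "\<bar>g y $ 2 - s0\<bar> \<le> 1" "norm (Fs (g y $ 1) (g y $ 2)) \<ge> 1 / 2"
      using gU[OF y] by (auto simp: U_def)
    show "g y $ 1 > 0" if "y \<in> \<Omega>"
    proof (rule ccontr)
      assume "\<not> g y $ 1 > 0"
      then have "F (g y $ 1) (g y $ 2) \<notin> \<Omega>"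
        using gU[OF y] by (intro \<delta>(2)) (auto simp: U_def)
      then show False using F that by simp
    qed
  next
    have "g (f x0) = x0" using IFT(3,6) by (auto simp: homeomorphism_def)
    then show "g (\<gamma> s0) $ 1 = 0" unfolding fx0 by (simp add: x0_def)
  qed
qed

end

subsection \<open>The flux through a normal segment\<close>

text \<open>Bridge between the hypothesis, a Lebesgue integral with values in
  \<open>[0, \<infinity>]\<close> over the whole open interval, and the gauge integral over a
  compact part of it.\<close>

lemma abs_integral_le_set_nn_integral:
  fixes f :: "real \<Rightarrow> real"
  assumes f: "continuous_on {a..b} f" and "l < a" "b \<le> r"
    and D: "set_nn_integral lborel {l<..<r} (\<lambda>u. ennreal \<bar>f u\<bar>) \<le> ennreal D" "D \<ge> 0"
  shows "\<bar>integral {a..b} f\<bar> \<le> D"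
proof -
  have ca: "continuous_on {a..b} (\<lambda>u. \<bar>f u\<bar>)" using f by (intro continuous_intros)
  note int = borel_integrable_atLeastAtMost'[OF ca]
  have "ennreal (integral {a..b} (\<lambda>u. \<bar>f u\<bar>)) =
      ennreal (\<integral>u. indicator {a..b} u *\<^sub>R \<bar>f u\<bar> \<partial>lborel)"
    using set_borel_integral_eq_integral(2)[OF int] by (simp add: set_lebesgue_integral_def)
  also have "\<dots> = (\<integral>\<^sup>+u. ennreal (indicator {a..b} u *\<^sub>R \<bar>f u\<bar>) \<partial>lborel)"
    by (rule nn_integral_eq_integral[symmetric])
      (use int in \<open>auto simp: set_integrable_def\<close>)
  \<comment> \<open>If \<open>b = r\<close>, the point \<open>b\<close> lies outside the open
    interval; it is a null set.\<close>
  also have "\<dots> \<le> set_nn_integral lborel {l<..<r} (\<lambda>u. ennreal \<bar>f u\<bar>)"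
    by (intro nn_integral_mono_AE eventually_mono[OF AE_lborel_singleton[of b]])
      (use assms in \<open>auto simp: indicator_def\<close>)
  also note D(1)
  finally have "integral {a..b} (\<lambda>u. \<bar>f u\<bar>) \<le> D" using D(2) by simp
  moreover have "\<bar>integral {a..b} f\<bar> \<le> integral {a..b} (\<lambda>u. \<bar>f u\<bar>)"
    using integral_norm_bound_integral[of f "{a..b}" "\<lambda>u. \<bar>f u\<bar>"]
    by (simp add: integrable_continuous_real f ca)
  ultimately show ?thesis by simp
qed

lemma integral_lower_endpoint_has_derivative:
  fixes f :: "real \<Rightarrow> real"
  assumes "continuous_on {a..b} f" "a < x" "x < b"
  shows "((\<lambda>u. integral {u..b} f) has_real_derivative - f x) (at x)"
proof -
  have int: "f integrable_on {a..b}" using assms(1) by (rule integrable_continuous_real)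
  have "((\<lambda>u. integral {a..u} f) has_vector_derivative f x) (at x within {a..b})"
    using assms by (intro integral_has_vector_derivative) auto
  then have "((\<lambda>u. integral {a..u} f) has_vector_derivative f x) (at x within {a<..<b})"
    by (rule has_vector_derivative_within_subset) auto
  then have "((\<lambda>u. integral {a..u} f) has_real_derivative f x) (at x)"
    using assms by (simp add: at_within_open[of x "{a<..<b}"] has_real_derivative_iff_has_vector_derivative)
  then have "((\<lambda>u. integral {a..b} f - integral {a..u} f) has_real_derivative - f x) (at x)"
    by (auto intro!: derivative_eq_intros)
  then show ?thesis
  proof (rule has_field_derivative_transform_within_open[of _ _ _ "{a<..<b}"])
    fix u assume "u \<in> {a<..<b}"
    then show "integral {a..b} f - integral {a..u} f = integral {u..b} f"
      using Henstock_Kurzweil_Integration.integral_combine[of a u b f] int by auto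
  qed (use assms in auto)
qed

text \<open>The analysis of the flux, detached from geometry: \<open>b\<close> stands for the field
  coefficient, \<open>\<beta>\<close> for its \<open>s\<close>-derivative. As \<open>N < N'\<close>,
  both are continuous up to \<open>n = N\<close>, while \<open>n = 0\<close> may be
  singular.\<close>

locale flux =
  fixes b \<beta> :: "real \<Rightarrow> real \<Rightarrow> real" and N N' D :: real
  assumes N: "N < N'" and D: "D \<ge> 0"
    and deriv: "\<And>n s. 0 < n \<Longrightarrow> n < N' \<Longrightarrow> ((\<lambda>s. b n s) has_real_derivative \<beta> n s) (at s)"
    and cont_b: "continuous_on ({0<..<N'} \<times> UNIV) (\<lambda>p. b (fst p) (snd p))"
    and cont_\<beta>: "continuous_on ({0<..<N'} \<times> UNIV) (\<lambda>p. \<beta> (fst p) (snd p))"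
    and bound: "\<And>s. set_nn_integral lborel {0<..<N} (\<lambda>u. ennreal \<bar>\<beta> u s\<bar>) \<le> ennreal D"
begin

text \<open>The form \<open>- prim ds\<close> has exterior derivative
  \<open>b dn \<and> ds\<close>.\<close>

definition prim where "prim n s = integral {n..N} (\<lambda>u. b u s)"

lemma cont_compose:
  assumes "continuous_on T f" "continuous_on T g" "\<And>x. x \<in> T \<Longrightarrow> 0 < f x \<and> f x < N'"
  shows "continuous_on T (\<lambda>x. b (f x) (g x))" "continuous_on T (\<lambda>x. \<beta> (f x) (g x))"
proof -
  have "continuous_on T (\<lambda>x. (f x, g x))" "(\<lambda>x. (f x, g x)) ` T \<subseteq> {0<..<N'} \<times> UNIV"
    using assms by (auto intro: continuous_on_Pair)
  then show "continuous_on T (\<lambda>x. b (f x) (g x))" "continuous_on T (\<lambda>x. \<beta> (f x) (g x))"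
    using continuous_on_compose2[OF cont_b] continuous_on_compose2[OF cont_\<beta>] by fastforce+
qed

lemma cont_b': "0 < n \<Longrightarrow> continuous_on {n..N} (\<lambda>u. b u s)"
  using N by (intro cont_compose continuous_intros) auto

text \<open>Differentiation under the integral sign. The bound \<open>D\<close> does not depend on
  \<open>n\<close>, even where \<open>prim\<close> blows up as \<open>n\<close> tends to 0.\<close>

lemma prim_s:
  assumes "0 < n"
  obtains k where "\<bar>k\<bar> \<le> D" "((\<lambda>s. prim n s) has_real_derivative k) (at s)"
proof
  show "\<bar>integral {n..N} (\<lambda>u. \<beta> u s)\<bar> \<le> D"
    by (rule abs_integral_le_set_nn_integral[OF _ _ _ bound D])
      (use assms N in \<open>auto intro!: cont_compose continuous_intros\<close>)
  have "((\<lambda>s. integral (cbox n N) (\<lambda>u. b u s)) has_field_derivative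
      integral (cbox n N) (\<lambda>u. \<beta> u s)) (at s within UNIV)"
  proof (rule leibniz_rule_field_derivative)
    show "continuous_on (UNIV \<times> cbox n N) (\<lambda>(x, t). \<beta> t x)"
      unfolding case_prod_unfold
      using assms N by (intro cont_compose continuous_intros) auto
    show "(\<lambda>u. b u x) integrable_on cbox n N" for x
      using cont_b'[OF assms, of x] by (simp add: integrable_continuous_real)
  qed (use assms N in \<open>auto intro!: deriv\<close>)
  then show "((\<lambda>s. prim n s) has_real_derivative integral {n..N} (\<lambda>u. \<beta> u s)) (at s)"
    by (simp add: prim_def)
qed

lemma prim_lipschitz:
  assumes "0 < n"
  shows "\<bar>prim n s - prim n s'\<bar> \<le> D * \<bar>s - s'\<bar>"
proof -
  have "\<forall>s. \<exists>k. \<bar>k\<bar> \<le> D \<and> ((\<lambda>s. prim n s) has_real_derivative k) (at s)"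
    using prim_s[OF assms] by metis
  then obtain k where k: "\<And>s. \<bar>k s\<bar> \<le> D" "\<And>s. ((\<lambda>s. prim n s) has_real_derivative k s) (at s)"
    by metis
  show ?thesis
    using field_differentiable_bound[of UNIV "prim n" k D s s'] k by simp
qed

text \<open>Total differentiability comes from the \<open>s\<close>-derivative at the point and an
  \<open>n\<close>-derivative, \<open>- b\<close>, that is jointly continuous.\<close>

lemma prim_has_derivative:
  assumes "0 < n" "n < N"
  obtains k where "\<bar>k\<bar> \<le> D"
    "((\<lambda>p. prim (snd p) (fst p)) has_derivative (\<lambda>h. k * fst h - b n s * snd h)) (at (s, n))"
proof -
  obtain k where k: "\<bar>k\<bar> \<le> D" "((\<lambda>s. prim n s) has_real_derivative k) (at s)"
    using prim_s[OF assms(1)] by metis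
  \<comment> \<open>The lower end \<open>n / 2\<close> keeps the integrand away from the singularity
    at 0 and leaves \<open>n\<close> in the interior.\<close>
  let ?Y = "{n / 2<..<N}"
  have "((\<lambda>(s, n). prim n s) has_derivative
      (\<lambda>(hs, hn). k * hs + blinfun_apply (blinfun_scaleR_left (- b n s)) hn)) (at (s, n) within UNIV \<times> ?Y)"
  proof (rule has_derivative_partialsI[where fy = "\<lambda>s n. blinfun_scaleR_left (- b n s)"])
    show "((\<lambda>s. prim n s) has_derivative (*) k) (at s within UNIV)"
      using k(2) by (simp add: has_field_derivative_def)
    show "((\<lambda>n. prim n s) has_derivative blinfun_apply (blinfun_scaleR_left (- b n s))) (at n within ?Y)"
      if "n \<in> ?Y" for s n
    proof (rule has_derivative_at_withinI)
      have "((\<lambda>n. prim n s) has_real_derivative - b n s) (at n)"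
        unfolding prim_def
        by (rule integral_lower_endpoint_has_derivative[OF cont_b'[of "n / 2"]])
          (use that assms in auto)
      then show "((\<lambda>n. prim n s) has_derivative blinfun_apply (blinfun_scaleR_left (- b n s))) (at n)"
        unfolding has_field_derivative_def
        by (rule has_derivative_eq_rhs) (simp add: fun_eq_iff)
    qed
    have "continuous_on (UNIV \<times> ?Y) (\<lambda>p. blinfun_scaleR_left (- b (snd p) (fst p)))"
      by (intro bounded_linear.continuous_on[OF bounded_linear_blinfun_scaleR_left]
          continuous_on_minus cont_compose continuous_intros) (use assms N in auto)
    then show "continuous (at (s, n) within UNIV \<times> ?Y) (\<lambda>(s, n). blinfun_scaleR_left (- b n s))"
      using assms by (simp add: continuous_on_eq_continuous_within case_prod_unfold)
  qed (use assms in auto)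
  moreover have "at (s, n) within UNIV \<times> ?Y = at (s, n)"
    using assms by (intro at_within_open open_Times) auto
  ultimately have "((\<lambda>p. prim (snd p) (fst p)) has_derivative (\<lambda>h. k * fst h - b n s * snd h)) (at (s, n))"
    by (simp add: case_prod_unfold mult.commute[of "b n s"])
  with k(1) that show ?thesis by blast
qed

end

subsection \<open>Motion in the collar\<close>

context collar
begin

lemma normal_coeff_eq:
  "normal_coeff B \<gamma> \<nu> n s = blinfun_apply (blinfun_apply (B (F n s)) (\<nu> s)) (Fs n s)"
proof -
  have 1: "vector_derivative (\<lambda>u. normal_map \<gamma> \<nu> (u, s)) (at n) = \<nu> s"
    unfolding normal_map_def
    by (rule vector_derivative_at) (auto intro!: derivative_eq_intros)
  have 2: "vector_derivative (\<lambda>t. normal_map \<gamma> \<nu> (n, t)) (at s) = Fs n s"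
    using F_vd[of n s] by (simp add: normal_map_def vector_derivative_at F_def)
  show ?thesis unfolding normal_coeff_def 1 2 by (simp add: normal_map_def F_def)
qed

lemma F_in: "0 < n \<Longrightarrow> n < N' \<Longrightarrow> F n s \<in> \<Omega>"
  unfolding F_def by (rule subset)

lemma flux_normal_coeff:
  assumes B: "smooth_on \<Omega> B"
    and D: "\<And>s. set_nn_integral lborel {0<..<N}
      (\<lambda>u. ennreal \<bar>deriv (\<lambda>t. normal_coeff B \<gamma> \<nu> u t) s\<bar>) \<le> ennreal D" "D \<ge> 0"
  shows "flux (normal_coeff B \<gamma> \<nu>) (\<lambda>n. deriv (\<lambda>t. normal_coeff B \<gamma> \<nu> n t)) N N' D"
proof -
  \<comment> \<open>Product rule for the value of \<open>B\<close> on \<open>\<nu>\<close> and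
    \<open>Fs\<close>; unlike \<open>deriv\<close>, this expression is visibly continuous in both
    variables.\<close>
  define \<beta> where "\<beta> n s =
    blinfun_apply (blinfun_apply (frechet_derivative B (at (F n s)) (Fs n s)) (\<nu> s)) (Fs n s) +
    blinfun_apply (blinfun_apply (B (F n s)) (\<nu>1 s)) (Fs n s) +
    blinfun_apply (blinfun_apply (B (F n s)) (\<nu> s)) (\<gamma>2 s + n *\<^sub>R \<nu>2 s)" for n s
  have \<beta>: "((\<lambda>s. normal_coeff B \<gamma> \<nu> n s) has_real_derivative \<beta> n s) (at s)"
    if "0 < n" "n < N'" for n s
  proof -
    have "((\<lambda>s. B (F n s)) has_vector_derivative frechet_derivative B (at (F n s)) (Fs n s)) (at s)"
      by (rule smooth_on_compose_vector_derivative[OF B F_vd F_in[OF that]])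
    note bounded_bilinear.has_vector_derivative[OF bounded_bilinear_blinfun_apply
        bounded_bilinear.has_vector_derivative[OF bounded_bilinear_blinfun_apply this \<nu>] Fs_vd]
    then show ?thesis
      by (simp add: has_real_derivative_iff_has_vector_derivative normal_coeff_eq \<beta>_def
          blinfun.add_left algebra_simps)
  qed
  have deriv: "deriv (\<lambda>t. normal_coeff B \<gamma> \<nu> n t) s = \<beta> n s" if "0 < n" "n < N'" for n s
    using \<beta>[OF that] by (rule DERIV_imp_deriv)
  let ?T = "{0<..<N'} \<times> (UNIV :: real set)"
  have cB: "continuous_on ?T (\<lambda>p. B (F (fst p) (snd p)))"
    by (rule continuous_on_compose2[OF smooth_on_imp_continuous_on[OF B]])
      (auto intro!: cont_F continuous_intros F_in)
  have cDB: "continuous_on ?T (\<lambda>p. frechet_derivative B (at (F (fst p) (snd p))) (Fs (fst p) (snd p)))"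
    by (rule continuous_on_frechet_derivative[OF B])
      (auto intro!: cont_F cont_Fs continuous_intros F_in)
  show ?thesis
  proof
    show "continuous_on ?T (\<lambda>p. normal_coeff B \<gamma> \<nu> (fst p) (snd p))"
      unfolding normal_coeff_eq
      by (intro continuous_intros cB cont_compose cont_Fs)
    have "continuous_on ?T (\<lambda>p. \<beta> (fst p) (snd p))"
      unfolding \<beta>_def by (intro continuous_intros cB cDB cont_compose cont_Fs)
    then show "continuous_on ?T (\<lambda>p. deriv (\<lambda>t. normal_coeff B \<gamma> \<nu> (fst p) t) (snd p))"
      by (rule continuous_on_eq) (auto simp: deriv)
    show "((\<lambda>s. normal_coeff B \<gamma> \<nu> n s) has_real_derivative deriv (\<lambda>t. normal_coeff B \<gamma> \<nu> n t) s) (at s)"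
      if "0 < n" "n < N'" for n s
      using \<beta>[OF that] deriv[OF that] by simp
  qed (use N D in auto)
qed

text \<open>Stated for Newton's law with the field alone, so that the local gauge can be built into
  the momentum \<open>P\<close> without reference to the potential in the Hamiltonian.\<close>

lemma charged_particle_no_collision:
  fixes q v :: "real \<Rightarrow> plane"
  assumes bdry: "smooth_boundary \<Omega>" and B: "smooth_2form \<Omega> B"
    and D: "\<And>s. set_nn_integral lborel {0<..<N}
      (\<lambda>u. ennreal \<bar>deriv (\<lambda>t. normal_coeff B \<gamma> \<nu> u t) s\<bar>) \<le> ennreal D" "D \<ge> 0"
    and div: "filterlim (\<lambda>n. \<bar>integral {n..N} (\<lambda>u. normal_coeff B \<gamma> \<nu> u s0)\<bar>) at_top (at_right 0)"
    and m: "m > 0" and e: "e \<noteq> 0"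
    and I: "open I" "is_interval I" "b0 \<in> closure I" "b0 \<notin> I"
    and q\<Omega>: "\<And>t. t \<in> I \<Longrightarrow> q t \<in> \<Omega>"
    and q': "\<And>t. t \<in> I \<Longrightarrow> (q has_vector_derivative v t) (at t)"
    and v': "\<And>t. t \<in> I \<Longrightarrow> \<exists>a. (v has_vector_derivative a) (at t) \<and>
      (\<forall>w. m * (a \<bullet> w) = e * blinfun_apply (blinfun_apply (B (q t)) w) (v t))"
    and speed: "\<And>t. t \<in> I \<Longrightarrow> norm (v t) \<le> \<sigma>"
    and lim: "(q \<longlongrightarrow> \<gamma> s0) (at b0 within I)"
  shows False
proof -
  let ?b = "normal_coeff B \<gamma> \<nu>"
  have Bs: "smooth_on \<Omega> B" and Balt: "\<And>y u. y \<in> \<Omega> \<Longrightarrow> blinfun_apply (blinfun_apply (B y) u) u = 0"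
    using B by (auto simp: smooth_2form_def)
  interpret fl: flux ?b "\<lambda>n. deriv (\<lambda>t. ?b n t)" N N' D
    by (rule flux_normal_coeff[OF Bs D])
  obtain V nn ss nn' ss' where V: "open V" "\<gamma> s0 \<in> V"
    and Fy: "\<And>y. y \<in> V \<Longrightarrow> F (nn y) (ss y) = y"
    and nn': "\<And>y. y \<in> V \<Longrightarrow> (nn has_derivative nn' y) (at y)"
    and ss': "\<And>y. y \<in> V \<Longrightarrow> (ss has_derivative ss' y) (at y)"
    and nn0: "nn (\<gamma> s0) = (0::real)"
    and nnN: "\<And>y. y \<in> V \<Longrightarrow> nn y < N" and ss1: "\<And>y. y \<in> V \<Longrightarrow> \<bar>ss y - s0\<bar> \<le> 1"
    and Fs2: "\<And>y. y \<in> V \<Longrightarrow> norm (Fs (nn y) (ss y)) \<ge> 1 / 2"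
    and nnpos: "\<And>y. y \<in> V \<Longrightarrow> y \<in> \<Omega> \<Longrightarrow> nn y > 0"
    by (rule normal_coordinates_at_boundary[OF bdry, of s0]) (rule that)
  have "\<forall>\<^sub>F t in at b0 within I. q t \<in> V" using lim V by (rule topological_tendstoD)
  then obtain \<eta> where "\<eta> > 0" "\<forall>t\<in>I. t \<noteq> b0 \<and> dist t b0 < \<eta> \<longrightarrow> q t \<in> V"
    unfolding eventually_at by auto
  then have \<eta>: "\<eta> > 0" "t \<in> I \<Longrightarrow> dist t b0 < \<eta> \<Longrightarrow> q t \<in> V" for t
    using I(4) by auto
  \<comment> \<open>Near \<open>b0\<close> the path stays in the coordinate patch; \<open>J\<close>
    remains convex, so a bound on a derivative bounds the total change.\<close>
  define J where "J = I \<inter> ball b0 \<eta>"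
  have JI: "J \<subseteq> I" and JV: "\<And>t. t \<in> J \<Longrightarrow> q t \<in> V" and J: "open J" "convex J"
    using I \<eta> by (auto simp: J_def dist_commute is_interval_convex_1 intro!: convex_Int)
  have nt: "at b0 within I \<noteq> bot"
    using I(3,4) by (simp add: at_within_eq_bot_iff)
  have evJ: "\<forall>\<^sub>F t in at b0 within I. t \<in> J"
    using \<eta> by (auto simp: eventually_at J_def dist_commute)
  define n s where "n t = nn (q t)" and "s t = ss (q t)" for t
  define nd sd where "nd t = nn' (q t) (v t)" and "sd t = ss' (q t) (v t)" for t
  have nvd: "(n has_vector_derivative nd t) (at t)" and svd: "(s has_vector_derivative sd t) (at t)"
    if t: "t \<in> J" for t
  proof -
    have *: "((\<lambda>t. f (q t)) has_vector_derivative f' (v t)) (at t)"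
      if "(f has_derivative f') (at (q t))" for f :: "plane \<Rightarrow> real" and f'
      using has_derivative_compose[OF q'[unfolded has_vector_derivative_def] that] t JI
        linear_scale[OF has_derivative_linear[OF that]]
      by (auto simp: has_vector_derivative_def)
    show "(n has_vector_derivative nd t) (at t)" "(s has_vector_derivative sd t) (at t)"
      unfolding n_def[abs_def] s_def[abs_def] nd_def sd_def
      by (rule *[OF nn'[OF JV[OF t]]], rule *[OF ss'[OF JV[OF t]]])
  qed
  have nN: "0 < n t" "n t < N" and s1: "\<bar>s t - s0\<bar> \<le> 1"
    and X2: "norm (Fs (n t) (s t)) \<ge> 1 / 2" and qF: "F (n t) (s t) = q t" if "t \<in> J" for t
    using JV[OF that] nnpos nnN ss1 Fs2 Fy q\<Omega> JI that by (auto simp: n_def s_def)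
  have cs: "((\<lambda>t. f (s t)) has_vector_derivative sd t *\<^sub>R f' (s t)) (at t)"
    if "t \<in> J" "\<And>s. (f has_vector_derivative f' s) (at s)" for f f' :: "real \<Rightarrow> plane" and t
    using vector_diff_chain_at[OF svd[OF that(1)] that(2)] by (simp add: o_def)
  have ns: "((\<lambda>t. n t *\<^sub>R f (s t)) has_vector_derivative
      n t *\<^sub>R (sd t *\<^sub>R f' (s t)) + nd t *\<^sub>R f (s t)) (at t)"
    if "t \<in> J" "\<And>s. (f has_vector_derivative f' s) (at s)" for f f' :: "real \<Rightarrow> plane" and t
    by (intro bounded_bilinear.has_vector_derivative[OF bounded_bilinear_scaleR]
        nvd[OF that(1)] cs[OF that])
  \<comment> \<open>Differentiating \<open>q = F n s\<close> identifies \<open>nd\<close> and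
    \<open>sd\<close> as the components of the velocity.\<close>
  have v_eq: "v t = nd t *\<^sub>R \<nu> (s t) + sd t *\<^sub>R Fs (n t) (s t)" if t: "t \<in> J" for t
  proof -
    have "((\<lambda>t. F (n t) (s t)) has_vector_derivative
        sd t *\<^sub>R \<gamma>1 (s t) + (n t *\<^sub>R (sd t *\<^sub>R \<nu>1 (s t)) + nd t *\<^sub>R \<nu> (s t))) (at t)"
      unfolding F_def by (intro has_vector_derivative_add cs ns t \<gamma> \<nu>)
    then have "(q has_vector_derivative
        sd t *\<^sub>R \<gamma>1 (s t) + (n t *\<^sub>R (sd t *\<^sub>R \<nu>1 (s t)) + nd t *\<^sub>R \<nu> (s t))) (at t)"
      by (rule has_vector_derivative_transform_within_open[OF _ J(1) t]) (rule qF)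
    from vector_derivative_unique_at[OF this q'] t JI show ?thesis
      by (auto simp: Fs_def algebra_simps)
  qed
  have \<sigma>0: "\<sigma> \<ge> 0"
  proof -
    obtain t where "t \<in> I" using I(3) by (metis all_not_in_conv closure_empty)
    then show ?thesis using speed[of t] norm_ge_zero[of "v t"] by linarith
  qed
  have nd_le: "\<bar>nd t\<bar> \<le> \<sigma>" if t: "t \<in> J" for t
  proof -
    have "\<nu> (s t) \<bullet> v t = nd t"
      using unit(2)[of "s t"] \<nu>_Fs[of "s t" "n t"] unfolding v_eq[OF t]
      by (simp add: norm_eq_1 inner_add_right)
    then have "v t \<bullet> \<nu> (s t) = nd t" by (simp add: inner_commute)
    then show ?thesis
      using Cauchy_Schwarz_ineq2[of "v t" "\<nu> (s t)"] speed[of t] t JI unit(2) by auto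
  qed
  \<comment> \<open>The factor 2 stems from the lower bound 1/2 on the length of
    \<open>Fs\<close>.\<close>
  have sd_le: "\<bar>sd t\<bar> \<le> 2 * \<sigma>" if t: "t \<in> J" for t
  proof -
    let ?X = "Fs (n t) (s t)"
    have "v t \<bullet> ?X = sd t * (norm ?X * norm ?X)"
      using \<nu>_Fs[of "s t" "n t"]
      unfolding v_eq[OF t]
      by (simp add: inner_add_left flip: power2_norm_eq_inner power2_eq_square)
    then have "\<bar>sd t\<bar> * norm ?X * norm ?X \<le> norm (v t) * norm ?X"
      using Cauchy_Schwarz_ineq2[of "v t" ?X] by (simp add: abs_mult mult.assoc)
    then have "\<bar>sd t\<bar> * norm ?X \<le> norm (v t)" using X2[OF t] by (cases "?X = 0") (auto simp: mult_le_cancel_right)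
    moreover have "\<bar>sd t\<bar> * (1 / 2) \<le> \<bar>sd t\<bar> * norm ?X" using X2[OF t] by (intro mult_left_mono) auto
    ultimately show ?thesis using speed[of t] t JI by auto
  qed
  \<comment> \<open>Compactness of the range of \<open>s\<close> bounds \<open>\<gamma>2\<close>,
    \<open>\<nu>1\<close> and \<open>\<nu>2\<close> along the whole path by one constant.\<close>
  have "\<exists>M. \<forall>s\<in>cball s0 1. norm (f s) \<le> M" if "continuous_on UNIV f" for f :: "real \<Rightarrow> plane"
  proof -
    have "bounded (f ` cball s0 1)"
      by (intro compact_imp_bounded compact_continuous_image continuous_on_subset[OF that]) auto
    then show ?thesis by (auto simp: bounded_iff)
  qed
  then obtain M1 M2 M3 where M123: "\<And>s. s \<in> cball s0 1 \<Longrightarrow> norm (\<gamma>2 s) \<le> M1"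
     "\<And>s. s \<in> cball s0 1 \<Longrightarrow> norm (\<nu>1 s) \<le> M2" "\<And>s. s \<in> cball s0 1 \<Longrightarrow> norm (\<nu>2 s) \<le> M3"
    using cont by metis
  define M where "M = max M1 (max M2 M3)"
  have M: "norm (\<gamma>2 (s t)) \<le> M" "norm (\<nu>1 (s t)) \<le> M" "norm (\<nu>2 (s t)) \<le> M" if "t \<in> J" for t
    using M123[of "s t"] s1[OF that] by (auto simp: M_def dist_real_def abs_minus_commute)
  have M0: "M \<ge> 0" if "t \<in> J" for t using M(1)[OF that] norm_ge_zero order_trans by blast

  text \<open>\<open>P\<close> is the momentum conjugate to \<open>s\<close> in the gauge \<open>A = - prim ds\<close>. The magnetic force
    along \<open>ds\<close> is cancelled by the \<open>n\<close>-derivative of the gauge potential.\<close>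
  define P where "P t = m * (v t \<bullet> Fs (n t) (s t)) - e * fl.prim (n t) (s t)" for t
  \<comment> \<open>The first summand bounds \<open>m * (v t \<bullet> w)\<close>, where
    \<open>w\<close> is the time derivative of \<open>Fs\<close>, through \<open>n < N\<close> and
    the bounds \<open>\<sigma>\<close> on \<open>nd\<close> and \<open>2 * \<sigma>\<close> on
    \<open>sd\<close>; the second bounds the change of the flux due to motion in
    \<open>s\<close>.\<close>
  define K where "K = m * (\<sigma> * (2 * \<sigma> * M + N * (2 * \<sigma> * M) + \<sigma> * M)) + \<bar>e\<bar> * (D * (2 * \<sigma>))"
  have P': "\<exists>P'. (P has_vector_derivative P') (at t) \<and> norm P' \<le> K" if t: "t \<in> J" for t
  proof -
    have tI: "t \<in> I" using t JI by auto
    define X where "X = Fs (n t) (s t)"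
    define w where "w = sd t *\<^sub>R \<gamma>2 (s t) + (n t *\<^sub>R (sd t *\<^sub>R \<nu>2 (s t)) + nd t *\<^sub>R \<nu>1 (s t))"
    have X: "((\<lambda>t. Fs (n t) (s t)) has_vector_derivative w) (at t)"
      unfolding Fs_def w_def by (intro has_vector_derivative_add cs ns t \<gamma>1 \<nu>1)
    obtain a where a: "(v has_vector_derivative a) (at t)"
      "m * (a \<bullet> X) = e * blinfun_apply (blinfun_apply (B (q t)) X) (v t)"
      using v'[OF tI] by blast
    obtain k where k: "\<bar>k\<bar> \<le> D"
      "((\<lambda>p. fl.prim (snd p) (fst p)) has_derivative (\<lambda>h. k * fst h - ?b (n t) (s t) * snd h)) (at (s t, n t))"
      using fl.prim_has_derivative[OF nN[OF t]] by blast
    have "((\<lambda>t. (s t, n t)) has_derivative (\<lambda>h. (h *\<^sub>R sd t, h *\<^sub>R nd t))) (at t)"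
      using svd[OF t] nvd[OF t] unfolding has_vector_derivative_def by (rule has_derivative_Pair)
    from has_derivative_compose[OF this k(2)]
    have prim: "((\<lambda>t. fl.prim (n t) (s t)) has_vector_derivative k * sd t - ?b (n t) (s t) * nd t) (at t)"
      by (simp add: has_vector_derivative_def algebra_simps)
    let ?B = "\<lambda>u w. blinfun_apply (blinfun_apply (B (q t)) u) w"
    have skew: "?B X (\<nu> (s t)) = - ?B (\<nu> (s t)) X"
      using Balt[OF q\<Omega>[OF tI], of "X + \<nu> (s t)"] Balt[OF q\<Omega>[OF tI], of X] Balt[OF q\<Omega>[OF tI], of "\<nu> (s t)"]
      by (simp add: blinfun.add_left blinfun.add_right)
    \<comment> \<open>The \<open>Fs\<close> part of the velocity drops out because \<open>B\<close>
      is alternating; what remains may be unbounded but matches the \<open>n\<close>-derivative of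
      \<open>prim\<close>.\<close>
    have "?B X (v t) = - nd t * ?b (n t) (s t)"
      unfolding v_eq[OF t] normal_coeff_eq qF[OF t] X_def[symmetric]
      using skew Balt[OF q\<Omega>[OF tI], of X] by (simp add: blinfun.add_right blinfun.scaleR_right)
    then have aX: "m * (a \<bullet> X) = - e * (nd t * ?b (n t) (s t))" using a(2) by simp
    have "((\<lambda>t. v t \<bullet> Fs (n t) (s t)) has_vector_derivative v t \<bullet> w + a \<bullet> X) (at t)"
      unfolding X_def by (rule bounded_bilinear.has_vector_derivative[OF bounded_bilinear_inner a(1) X])
    then have "(P has_vector_derivative m * (v t \<bullet> w + a \<bullet> X) -
        e * (k * sd t - ?b (n t) (s t) * nd t)) (at t)"
      unfolding P_def[abs_def]
      by (intro has_vector_derivative_diff prim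
          bounded_linear.has_vector_derivative[OF bounded_linear_mult_right])
    moreover have "m * (v t \<bullet> w + a \<bullet> X) - e * (k * sd t - ?b (n t) (s t) * nd t) =
        m * (v t \<bullet> w) - e * (k * sd t)"
      using aX by (simp add: algebra_simps)
    moreover have "\<bar>m * (v t \<bullet> w) - e * (k * sd t)\<bar> \<le> K"
    proof -
      have "norm w \<le> 2 * \<sigma> * M + (N * (2 * \<sigma> * M) + \<sigma> * M)"
      proof -
        have "norm w \<le> norm (sd t *\<^sub>R \<gamma>2 (s t)) +
            (norm (n t *\<^sub>R (sd t *\<^sub>R \<nu>2 (s t))) + norm (nd t *\<^sub>R \<nu>1 (s t)))"
          unfolding w_def by (intro norm_triangle_le add_mono order_refl norm_triangle_ineq)
        also have "\<dots> \<le> 2 * \<sigma> * M + (N * (2 * \<sigma> * M) + \<sigma> * M)"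
          unfolding norm_scaleR
          using M[OF t] sd_le[OF t] nd_le[OF t] nN[OF t] \<sigma>0 M0[OF t]
          by (intro add_mono mult_mono) auto
        finally show ?thesis .
      qed
      then have "\<bar>v t \<bullet> w\<bar> \<le> \<sigma> * (2 * \<sigma> * M + N * (2 * \<sigma> * M) + \<sigma> * M)"
        using \<sigma>0 speed[OF tI] Cauchy_Schwarz_ineq2[of "v t" w]
        by (elim order_trans) (auto intro!: mult_mono)
      then have "\<bar>m * (v t \<bullet> w)\<bar> \<le> m * (\<sigma> * (2 * \<sigma> * M + N * (2 * \<sigma> * M) + \<sigma> * M))"
        using m by (simp add: abs_mult)
      moreover have "\<bar>e * (k * sd t)\<bar> \<le> \<bar>e\<bar> * (D * (2 * \<sigma>))"
        unfolding abs_mult using k(1) sd_le[OF t] D(2) by (intro mult_mono mult_left_mono) auto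
      ultimately show ?thesis unfolding K_def by linarith
    qed
    ultimately show ?thesis by (metis real_norm_def)
  qed
  then obtain P' where P': "\<And>t. t \<in> J \<Longrightarrow> (P has_vector_derivative P' t) (at t)"
    "\<And>t. t \<in> J \<Longrightarrow> norm (P' t) \<le> K" by metis
  obtain t1 where t1: "t1 \<in> J" using eventually_happens'[OF nt evJ] by blast
  have K0: "K \<ge> 0" using P'(2)[OF t1] norm_ge_zero order_trans by blast
  \<comment> \<open>Times in \<open>J\<close> differ by at most \<open>2 * \<eta>\<close>, and
    \<open>1 + N * M\<close> bounds the length of \<open>Fs\<close>.\<close>
  define C where "C = \<bar>P t1\<bar> + K * (2 * \<eta>) + m * (\<sigma> * (1 + N * M))"
  have bnd: "\<bar>e\<bar> * \<bar>fl.prim (n t) (s t)\<bar> \<le> C" if t: "t \<in> J" for t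
  proof -
    have "norm (P t - P t1) \<le> K * \<bar>t - t1\<bar>"
      by (rule vector_derivative_bound[OF J(2) has_vector_derivative_at_within[OF P'(1)] P'(2) t t1])
    also have "\<dots> \<le> K * (2 * \<eta>)"
      using t t1 K0 by (intro mult_left_mono) (auto simp: J_def dist_real_def)
    finally have 1: "\<bar>P t\<bar> \<le> \<bar>P t1\<bar> + K * (2 * \<eta>)" by simp
    have "norm (Fs (n t) (s t)) \<le> 1 + N * M"
    proof -
      have "norm (Fs (n t) (s t)) \<le> norm (\<gamma>1 (s t)) + norm (n t *\<^sub>R \<nu>1 (s t))"
        unfolding Fs_def by (rule norm_triangle_ineq)
      also have "norm (n t *\<^sub>R \<nu>1 (s t)) \<le> N * M"
        using M[OF t] nN[OF t] by (auto intro!: mult_mono)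
      finally show ?thesis by (simp add: unit)
    qed
    then have "\<bar>v t \<bullet> Fs (n t) (s t)\<bar> \<le> \<sigma> * (1 + N * M)"
      using \<sigma>0 speed[of t] t JI Cauchy_Schwarz_ineq2[of "v t" "Fs (n t) (s t)"]
      by (elim order_trans) (auto intro!: mult_mono)
    then have 2: "\<bar>m * (v t \<bullet> Fs (n t) (s t))\<bar> \<le> m * (\<sigma> * (1 + N * M))"
      using m by (simp add: abs_mult)
    have "\<bar>e * fl.prim (n t) (s t)\<bar> \<le> C"
      using 1 2 unfolding P_def C_def by linarith
    then show ?thesis by (simp add: abs_mult)
  qed
  \<comment> \<open>The extra \<open>D\<close> pays for moving from \<open>s t\<close> to
    \<open>s0\<close>, at distance at most 1.\<close>
  have "\<forall>\<^sub>F n in at_right 0. \<bar>fl.prim n s0\<bar> > C / \<bar>e\<bar> + D"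
    using div unfolding filterlim_at_top_dense fl.prim_def by blast
  then obtain d where d: "d > 0" "\<And>n. 0 < n \<Longrightarrow> n < d \<Longrightarrow> \<bar>fl.prim n s0\<bar> > C / \<bar>e\<bar> + D"
    unfolding eventually_at_right_field by auto
  have "isCont nn (\<gamma> s0)" using nn'[OF V(2)] by (rule has_derivative_continuous)
  then have "((\<lambda>t. nn (q t)) \<longlongrightarrow> nn (\<gamma> s0)) (at b0 within I)" using lim by (rule isCont_tendsto_compose)
  then have "\<forall>\<^sub>F t in at b0 within I. n t < d"
    unfolding nn0 n_def[symmetric] using d(1) by (rule order_tendstoD(2))
  with evJ have "\<forall>\<^sub>F t in at b0 within I. t \<in> J \<and> n t < d" by eventually_elim simp
  then obtain t where t: "t \<in> J" "n t < d" using eventually_happens'[OF nt] by blast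
  have "\<bar>fl.prim (n t) s0 - fl.prim (n t) (s t)\<bar> \<le> D * \<bar>s0 - s t\<bar>"
    by (rule fl.prim_lipschitz[OF nN(1)[OF t(1)]])
  also have "\<dots> \<le> D * 1" using s1[OF t(1)] D(2) by (intro mult_left_mono) auto
  finally have "\<bar>fl.prim (n t) s0\<bar> \<le> \<bar>fl.prim (n t) (s t)\<bar> + D" by linarith
  moreover have "\<bar>fl.prim (n t) (s t)\<bar> \<le> C / \<bar>e\<bar>"
    using bnd[OF t(1)] e by (simp add: field_simps)
  moreover have "\<bar>fl.prim (n t) s0\<bar> > C / \<bar>e\<bar> + D" using d(2) nN[OF t(1)] t(2) by blast
  ultimately show False by linarith
qed

end

text \<open>\<open>\<nu>\<close> is given as a mere function. Its regularity is read off from the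
  normal map on the slice \<open>n = N\<close>, which lies inside the cylinder as
  \<open>N < N'\<close>: subtract \<open>\<gamma>\<close> and divide by \<open>N\<close>.\<close>

lemma collar_of_normal_coordinates:
  assumes \<Omega>: "open \<Omega>" and C: "C \<subseteq> frontier \<Omega>" and N: "0 < N" "N < N'"
    and \<gamma>: "arclength_param C L \<gamma>" and \<nu>: "inward_unit_normal \<Omega> \<gamma> \<nu>"
    and V: "cylinder_diffeo N' L (normal_map \<gamma> \<nu>) V" "V \<subseteq> \<Omega>"
  shows "\<exists>\<gamma>1 \<gamma>2 \<nu>1 \<nu>2. collar \<Omega> \<gamma> \<gamma>1 \<gamma>2 \<nu> \<nu>1 \<nu>2 N N'"
proof -
  have s\<gamma>: "smooth_on UNIV \<gamma>" using \<gamma> by (simp add: arclength_param_def)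
  define \<gamma>1 where "\<gamma>1 s = frechet_derivative \<gamma> (at s) 1" for s
  define \<gamma>2 where "\<gamma>2 s = frechet_derivative \<gamma>1 (at s) 1" for s
  have s\<gamma>1: "smooth_on UNIV \<gamma>1"
    unfolding \<gamma>1_def[abs_def] by (rule smooth_on_frechet_derivative[OF s\<gamma>])
  have s\<gamma>2: "smooth_on UNIV \<gamma>2"
    unfolding \<gamma>2_def[abs_def] by (rule smooth_on_frechet_derivative[OF s\<gamma>1])
  have id: "((\<lambda>s::real. s) has_vector_derivative 1) (at s)" for s
    by (rule has_vector_derivative_id)
  have d\<gamma>: "(\<gamma> has_vector_derivative \<gamma>1 s) (at s)" for s
    using smooth_on_compose_vector_derivative[OF s\<gamma> id] by (simp add: \<gamma>1_def)
  have d\<gamma>1: "(\<gamma>1 has_vector_derivative \<gamma>2 s) (at s)" for s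
    using smooth_on_compose_vector_derivative[OF s\<gamma>1 id] by (simp add: \<gamma>2_def)
  let ?S = "{0<..<N'} \<times> (UNIV :: real set)"
  have s\<mu>: "smooth_on ?S (normal_map \<gamma> \<nu>)" using V by (simp add: cylinder_diffeo_def)
  define \<mu>1 where "\<mu>1 x = frechet_derivative (normal_map \<gamma> \<nu>) (at x) (0, 1)" for x
  define \<mu>2 where "\<mu>2 x = frechet_derivative \<mu>1 (at x) (0, 1)" for x
  have s\<mu>1: "smooth_on ?S \<mu>1"
    unfolding \<mu>1_def[abs_def] by (rule smooth_on_frechet_derivative[OF s\<mu>])
  have s\<mu>2: "smooth_on ?S \<mu>2"
    unfolding \<mu>2_def[abs_def] by (rule smooth_on_frechet_derivative[OF s\<mu>1])
  have pair: "((\<lambda>s. (N, s)) has_vector_derivative (0, 1)) (at s)" for s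
    by (intro has_vector_derivative_Pair has_vector_derivative_const id)
  have in_S: "(N, s) \<in> ?S" for s using N by simp
  have d\<mu>: "((\<lambda>s. normal_map \<gamma> \<nu> (N, s)) has_vector_derivative \<mu>1 (N, s)) (at s)" for s
    unfolding \<mu>1_def by (rule smooth_on_compose_vector_derivative[OF s\<mu> pair in_S])
  have d\<mu>1: "((\<lambda>s. \<mu>1 (N, s)) has_vector_derivative \<mu>2 (N, s)) (at s)" for s
    unfolding \<mu>2_def by (rule smooth_on_compose_vector_derivative[OF s\<mu>1 pair in_S])
  define \<nu>1 where "\<nu>1 s = (1 / N) *\<^sub>R (\<mu>1 (N, s) - \<gamma>1 s)" for s
  define \<nu>2 where "\<nu>2 s = (1 / N) *\<^sub>R (\<mu>2 (N, s) - \<gamma>2 s)" for s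
  have \<nu>_eq: "\<nu> = (\<lambda>s. (1 / N) *\<^sub>R (normal_map \<gamma> \<nu> (N, s) - \<gamma> s))"
    using N by (auto simp: normal_map_def)
  have "(\<nu> has_vector_derivative \<nu>1 s) (at s)" for s
    unfolding \<nu>1_def
    by (subst \<nu>_eq, intro bounded_linear.has_vector_derivative[OF bounded_linear_scaleR_right]
        has_vector_derivative_diff d\<mu> d\<gamma>)
  moreover have "(\<nu>1 has_vector_derivative \<nu>2 s) (at s)" for s
    unfolding \<nu>1_def[abs_def] \<nu>2_def
    by (intro bounded_linear.has_vector_derivative[OF bounded_linear_scaleR_right]
        has_vector_derivative_diff d\<mu>1 d\<gamma>1)
  moreover have "continuous_on UNIV \<nu>2"
    unfolding \<nu>2_def[abs_def] using N
    by (auto intro!: continuous_intros smooth_on_imp_continuous_on[OF s\<gamma>2]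
        continuous_on_compose2[OF smooth_on_imp_continuous_on[OF s\<mu>2]])
  moreover have "vector_derivative \<gamma> (at s) = \<gamma>1 s" for s
    using d\<gamma> by (rule vector_derivative_at)
  moreover have "\<gamma> s + n *\<^sub>R \<nu> s \<in> \<Omega>" if "0 < n" "n < N'" for n s
  proof -
    have "normal_map \<gamma> \<nu> (n, s) \<in> normal_map \<gamma> \<nu> ` ?S" using that by (intro imageI) simp
    then show ?thesis using V by (auto simp: cylinder_diffeo_def normal_map_def)
  qed
  moreover have "\<gamma> s \<in> frontier \<Omega>" for s
    using \<gamma> C by (auto simp: arclength_param_def)
  ultimately have "collar \<Omega> \<gamma> \<gamma>1 \<gamma>2 \<nu> \<nu>1 \<nu>2 N N'"
    using \<gamma> \<nu> C N \<Omega> d\<gamma> d\<gamma>1 smooth_on_imp_continuous_on[OF s\<gamma>2]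
    by unfold_locales (auto simp: arclength_param_def inward_unit_normal_def)
  then show ?thesis by blast
qed

subsection \<open>Completeness\<close>

text \<open>Energy conservation: a force orthogonal to the velocity does no work.\<close>

lemma norm_constant_if_derivative_orthogonal:
  fixes v :: "real \<Rightarrow> 'a::real_inner"
  assumes "convex I" "t0 \<in> I" "t \<in> I"
    and "\<And>t. t \<in> I \<Longrightarrow> \<exists>a. (v has_vector_derivative a) (at t) \<and> a \<bullet> v t = 0"
  shows "norm (v t) = norm (v t0)"
proof -
  have "norm ((\<lambda>t. v t \<bullet> v t) t - (\<lambda>t. v t \<bullet> v t) t0) \<le> 0 * \<bar>t - t0\<bar>"
  proof (rule vector_derivative_bound[OF assms(1) _ _ assms(3,2)])
    fix u assume "u \<in> I"
    then obtain a where a: "(v has_vector_derivative a) (at u)" "a \<bullet> v u = 0"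
      using assms(4) by blast
    have "((\<lambda>t. v t \<bullet> v t) has_vector_derivative v u \<bullet> a + a \<bullet> v u) (at u)"
      by (rule bounded_bilinear.has_vector_derivative[OF bounded_bilinear_inner a(1) a(1)])
    then show "((\<lambda>t. v t \<bullet> v t) has_vector_derivative 0) (at u within I)"
      using a(2) by (auto simp: inner_commute intro: has_vector_derivative_at_within)
  qed simp
  then show ?thesis by (simp add: norm_eq)
qed

text \<open>The velocity is confined to a compact ball, so it converges along a sequence of times;
  the momentum is recovered from velocity and \<open>A\<close>, which is continuous at the interior
  limit \<open>l\<close>.\<close>

lemma magnetic_cluster_point:
  assumes m: "m > 0" and \<Omega>: "open \<Omega>" and A: "smooth_on \<Omega> A"
    and c: "integral_curve (magnetic_field m e A) (\<Omega> \<times> UNIV) I c"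
    and b: "b0 \<in> closure I" "b0 \<notin> I"
    and speed: "\<And>t. t \<in> I \<Longrightarrow> norm (velocity m e A (c t)) \<le> \<sigma>"
    and lim: "((\<lambda>t. fst (c t)) \<longlongrightarrow> l) (at b0 within I)" "l \<in> \<Omega>"
  shows "\<exists>z\<in>\<Omega> \<times> UNIV. \<forall>r>0. \<forall>\<epsilon>>0. \<exists>t\<in>I. dist t b0 < \<epsilon> \<and> dist (c t) z < r"
proof -
  let ?v = "\<lambda>t. velocity m e A (c t)"
  obtain \<tau> where \<tau>: "\<And>k. \<tau> k \<in> I" "\<tau> \<longlonglongrightarrow> b0"
    using b(1) unfolding closure_sequential by blast
  have "\<forall>k. ?v (\<tau> k) \<in> cball 0 \<sigma>" using speed \<tau>(1) by simp
  then obtain w and r :: "nat \<Rightarrow> nat" where r: "strict_mono r" "(\<lambda>k. ?v (\<tau> (r k))) \<longlonglongrightarrow> w"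
    using seq_compactE[OF compact_imp_seq_compact[OF compact_cball], of "\<lambda>k. ?v (\<tau> k)" 0 \<sigma>]
    unfolding o_def by metis
  have \<tau>r: "(\<lambda>k. \<tau> (r k)) \<longlonglongrightarrow> b0"
    using LIMSEQ_subseq_LIMSEQ[OF \<tau>(2) r(1)] by (simp add: o_def)
  have "filterlim (\<lambda>k. \<tau> (r k)) (at b0 within I) sequentially"
    using \<tau>r \<tau>(1) b(2) by (auto simp: filterlim_at intro!: always_eventually)
  from filterlim_compose[OF lim(1) this] have q: "(\<lambda>k. fst (c (\<tau> (r k)))) \<longlonglongrightarrow> l" .
  have "isCont A l"
    using smooth_on_imp_continuous_on[OF A] \<Omega> lim(2) by (simp add: continuous_on_eq_continuous_at)
  then have Aq: "(\<lambda>k. A (fst (c (\<tau> (r k))))) \<longlonglongrightarrow> A l" using q by (rule isCont_tendsto_compose)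
  have c_eq: "c t = (fst (c t), blinfun_inner_right (m *\<^sub>R ?v t) + e *\<^sub>R A (fst (c t)))" for t
    using m by (simp add: velocity_def inner_right_sharp)
  define z where "z = (l, blinfun_inner_right (m *\<^sub>R w) + e *\<^sub>R A l)"
  have "(\<lambda>k. c (\<tau> (r k))) \<longlonglongrightarrow> z"
    unfolding z_def
    by (subst c_eq, intro tendsto_Pair q tendsto_add tendsto_scaleR tendsto_const Aq
        bounded_linear.tendsto[OF bounded_linear_blinfun_inner_right] r(2))
  then have "\<exists>t\<in>I. dist t b0 < \<epsilon> \<and> dist (c t) z < \<rho>" if "\<rho> > 0" "\<epsilon> > 0" for \<rho> \<epsilon>
  proof -
    have "\<forall>\<^sub>F k in sequentially. dist (c (\<tau> (r k))) z < \<rho> \<and> dist (\<tau> (r k)) b0 < \<epsilon>"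
      using tendstoD[OF \<open>(\<lambda>k. c (\<tau> (r k))) \<longlonglongrightarrow> z\<close> that(1)] tendstoD[OF \<tau>r that(2)]
      by eventually_elim simp
    then obtain k where "dist (c (\<tau> (r k))) z < \<rho> \<and> dist (\<tau> (r k)) b0 < \<epsilon>"
      using eventually_happens' sequentially_bot by blast
    then show ?thesis using \<tau>(1) by blast
  qed
  then show ?thesis using lim(2) by (intro bexI[of _ z]) (auto simp: z_def)
qed

text \<open>Integral curves stay in \<open>M\<close>, so values of the field outside it, where
  \<open>A\<close> may fail to be differentiable, do not matter.\<close>

lemma complete_on_cong:
  assumes "\<And>z. z \<in> M \<Longrightarrow> X z = Y z"
  shows "complete_on X M = complete_on Y M"
proof -
  have "integral_curve X M I c = integral_curve Y M I c" for I c
    unfolding integral_curve_def using assms by auto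
  then show ?thesis by (simp add: complete_on_def)
qed

theorem corollary1:
  fixes \<Omega> :: "plane set"
    and B :: "plane \<Rightarrow> plane \<Rightarrow>\<^sub>L covector"
    and A :: "plane \<Rightarrow> covector"
    and m e N :: real
    and L :: "plane set \<Rightarrow> real"
    and \<gamma> \<nu> :: "plane set \<Rightarrow> real \<Rightarrow> plane"
  assumes "m > 0" and "e \<noteq> 0"
    and "bounded_smooth_domain \<Omega>"
    and "smooth_2form \<Omega> B"
    and "\<And>C. C \<in> components (frontier \<Omega>) \<Longrightarrow> arclength_param C (L C) (\<gamma> C)"
    and "\<And>C. C \<in> components (frontier \<Omega>) \<Longrightarrow> inward_unit_normal \<Omega> (\<gamma> C) (\<nu> C)"
    and "N > 0"
    and "\<And>C. C \<in> components (frontier \<Omega>) \<Longrightarrow>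
           \<exists>N'>N. \<exists>V\<subseteq>\<Omega>. cylinder_diffeo N' (L C) (normal_map (\<gamma> C) (\<nu> C)) V"
    and "\<And>C s. C \<in> components (frontier \<Omega>) \<Longrightarrow>
           filterlim (\<lambda>n. \<bar>integral {n..N} (\<lambda>u. normal_coeff B (\<gamma> C) (\<nu> C) u s)\<bar>)
             at_top (at_right 0)"
    and "\<And>C. C \<in> components (frontier \<Omega>) \<Longrightarrow>
           \<exists>D::real. (SUP s. set_nn_integral lborel {0<..<N}
             (\<lambda>u. ennreal \<bar>deriv (\<lambda>t. normal_coeff B (\<gamma> C) (\<nu> C) u t) s\<bar>)) < ennreal D"
    and "smooth_1form \<Omega> A"
    and "\<And>q u v. q \<in> \<Omega> \<Longrightarrow> ext_deriv A q u v = blinfun_apply (blinfun_apply (B q) u) v"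
  shows "complete_on (hamiltonian_vector_field (magnetic_hamiltonian m e A)) (\<Omega> \<times> UNIV)"
proof -
  have \<Omega>: "open \<Omega>" and bdry: "smooth_boundary \<Omega>"
    using assms(3) by (auto simp: bounded_smooth_domain_def)
  have A: "smooth_on \<Omega> A" using assms(11) by (simp add: smooth_1form_def)
  have m: "m > 0" by fact
  let ?X = "magnetic_field m e A"
  have "complete_on ?X (\<Omega> \<times> UNIV)"
  proof (rule complete_onI)
    show "open (\<Omega> \<times> (UNIV :: covector set))" using \<Omega> by (intro open_Times) auto
    show "loclip_on (\<Omega> \<times> UNIV) ?X" by (rule loclip_on_magnetic_field[OF \<Omega> A])
    fix I c b0
    assume I: "open I" "is_interval I" and c: "integral_curve ?X (\<Omega> \<times> UNIV) I c"
      and b0: "b0 \<in> closure I" "b0 \<notin> I"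
    define q v where "q t = fst (c t)" and "v t = velocity m e A (c t)" for t
    have q\<Omega>: "q t \<in> \<Omega>" if "t \<in> I" for t
      using c that by (auto simp: integral_curve_def mem_Times_iff q_def)
    have q': "(q has_vector_derivative v t) (at t)" if "t \<in> I" for t
      using magnetic_newton(1)[OF _ A c that] m by (simp add: q_def[abs_def] v_def)
    have v': "\<exists>a. (v has_vector_derivative a) (at t) \<and>
        (\<forall>w. m * (a \<bullet> w) = e * blinfun_apply (blinfun_apply (B (q t)) w) (v t))" if "t \<in> I" for t
      using magnetic_newton(2)[OF _ A c that] m assms(12)[OF q\<Omega>[OF that]]
      by (simp add: q_def[abs_def] v_def[abs_def])
    obtain t0 where t0: "t0 \<in> I" using b0(1) by (metis all_not_in_conv closure_empty)
    have cI: "convex I" using I(2) by (simp add: is_interval_convex_1)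
    have speed: "norm (v t) = norm (v t0)" if "t \<in> I" for t
    proof (rule norm_constant_if_derivative_orthogonal[OF cI t0 that])
      fix t assume t: "t \<in> I"
      obtain a where a: "(v has_vector_derivative a) (at t)"
        "m * (a \<bullet> v t) = e * blinfun_apply (blinfun_apply (B (q t)) (v t)) (v t)"
        using v'[OF t] by blast
      moreover have "blinfun_apply (blinfun_apply (B (q t)) (v t)) (v t) = 0"
        using assms(4) q\<Omega>[OF t] by (simp add: smooth_2form_def)
      ultimately show "\<exists>a. (v has_vector_derivative a) (at t) \<and> a \<bullet> v t = 0" using m by auto
    qed
    have "(norm (v t0))-lipschitz_on I q"
    proof (rule lipschitz_onI)
      fix t t' assume "t \<in> I" "t' \<in> I"
      then show "dist (q t) (q t') \<le> norm (v t0) * dist t t'"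
        unfolding dist_norm real_norm_def
        by (intro vector_derivative_bound[OF cI has_vector_derivative_at_within[OF q']])
          (auto simp: speed)
    qed simp
    then have "uniformly_continuous_on I q" by (rule lipschitz_on_uniformly_continuous)
    then obtain l where l: "(q \<longlongrightarrow> l) (at b0 within I)"
      using uniformly_continuous_on_extension_at_closure b0(1) by metis
    have nt: "at b0 within I \<noteq> bot" using b0 by (simp add: at_within_eq_bot_iff)
    have "l \<in> closure \<Omega>"
      by (rule Lim_in_closed_set[OF closed_closure _ nt l])
        (use q\<Omega> in \<open>auto simp: eventually_at_filter
          intro!: always_eventually closure_subset[THEN subsetD]\<close>)
    show "\<exists>z\<in>\<Omega> \<times> UNIV. \<forall>r>0. \<forall>\<epsilon>>0. \<exists>t\<in>I. dist t b0 < \<epsilon> \<and> dist (c t) z < r"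
    proof (cases "l \<in> \<Omega>")
      case True
      show ?thesis
        by (rule magnetic_cluster_point[OF m \<Omega> A c b0 _ _ True])
          (use speed l in \<open>auto simp: v_def q_def[abs_def]\<close>)
    next
      case False
      then have lf: "l \<in> frontier \<Omega>"
        using \<open>l \<in> closure \<Omega>\<close> \<Omega> by (simp add: frontier_def interior_open)
      define C where "C = connected_component_set (frontier \<Omega>) l"
      have C: "C \<in> components (frontier \<Omega>)" and lC: "l \<in> C"
        using lf by (auto simp: C_def components_def)
      have "range (\<gamma> C) = C" using assms(5)[OF C] by (simp add: arclength_param_def)
      then obtain s0 where s0: "l = \<gamma> C s0" using lC by blast
      obtain N' V where NV: "N < N'" "V \<subseteq> \<Omega>" "cylinder_diffeo N' (L C) (normal_map (\<gamma> C) (\<nu> C)) V"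
        using assms(8)[OF C] by blast
      obtain \<gamma>1 \<gamma>2 \<nu>1 \<nu>2 where "collar \<Omega> (\<gamma> C) \<gamma>1 \<gamma>2 (\<nu> C) \<nu>1 \<nu>2 N N'"
        using collar_of_normal_coordinates[OF \<Omega> in_components_subset[OF C] assms(7) NV(1)
            assms(5)[OF C] assms(6)[OF C] NV(3,2)] by blast
      then interpret collar \<Omega> "\<gamma> C" \<gamma>1 \<gamma>2 "\<nu> C" \<nu>1 \<nu>2 N N' .
      let ?I = "\<lambda>s. set_nn_integral lborel {0<..<N}
        (\<lambda>u. ennreal \<bar>deriv (\<lambda>t. normal_coeff B (\<gamma> C) (\<nu> C) u t) s\<bar>)"
      obtain D where D: "(SUP s. ?I s) < ennreal D" using assms(10)[OF C] by blast
      have D1: "?I s \<le> ennreal D" for s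
        by (rule order_trans[OF SUP_upper[OF UNIV_I] less_imp_le[OF D]])
      \<comment> \<open>\<open>ennreal\<close> sends negative numbers to 0, and nothing lies
        strictly below 0.\<close>
      have D0: "D \<ge> 0" using D by (cases "D \<ge> 0") (auto simp: ennreal_neg)
      have False
        by (rule charged_particle_no_collision[OF bdry assms(4) D1 D0 assms(9)[OF C] m assms(2) I b0
              q\<Omega> q' v' _ l[unfolded s0], of "norm (v t0)"])
          (simp_all add: speed)
      then show ?thesis ..
    qed
  qed
  moreover have "hamiltonian_vector_field (magnetic_hamiltonian m e A) z = ?X z"
    if "z \<in> \<Omega> \<times> UNIV" for z
    using that m differentiableI[OF smooth_on_has_derivative[OF A]]
    by (intro hamiltonian_vector_field_magnetic) auto
  ultimately show ?thesis using complete_on_cong by metis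
qed

end
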